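(* An almost multichainable relational structure having a finite signature has only finitely many bounds (up to isomorphism).
   Context: Relational structure $R=(E,(\rho_i)_{i\in I})$ with $\rho_i\subseteq E^{m_i}$; finite signature means $I$ finite. $R$ is almost multichainable if there are a finite $F\subseteq E$, a finite set $V$, a linearly ordered set $L$ and a bijective enumeration $(a_{x,y})_{(x,y)\in V\times L}$ of $E\setminus F$ such that for every local isomorphism $f$ of $L$ (order isomorphism between subsets), the map $a_{x,y}\mapsto a_{x,f(y)}$ extended by the identity on $F$ is a local isomorphism (isomorphism between induced substructures) of $R$. A bound of $R$ is a relational structure $S$ of the same signature on a finite set $F'$ such that $S$ does not embed into $R$ but $S_{\restriction F'\setminus\{x\}}$ embeds into $R$ for every $x\in F'$. *)

theory Defs
  imports Main
begin

record 'i signature =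
  symbols :: "'i set"
  arity :: "'i \<Rightarrow> nat"

text \<open>An \<open>m\<close>-tuple over \<open>E\<close> is a list of length \<open>m\<close> with entries in \<open>E\<close>. The values
  \<open>rels R i\<close> for \<open>i\<close> outside the signature are never consulted.\<close>

record ('i, 'a) rel_structure =
  base_set :: "'a set"
  rels :: "'i \<Rightarrow> 'a list set"

definition tuples :: "nat \<Rightarrow> 'a set \<Rightarrow> 'a list set" where
  "tuples m E = {xs. set xs \<subseteq> E \<and> length xs = m}"

definition is_structure :: "'i signature \<Rightarrow> ('i, 'a) rel_structure \<Rightarrow> bool" where
  "is_structure \<sigma> R \<longleftrightarrow> (\<forall>i\<in>symbols \<sigma>. rels R i \<subseteq> tuples (arity \<sigma> i) (base_set R))"

definition induced :: "('i, 'a) rel_structure \<Rightarrow> 'a set \<Rightarrow> ('i, 'a) rel_structure" where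
  "induced R A = \<lparr>base_set = base_set R \<inter> A, rels = (\<lambda>i. rels R i \<inter> lists A)\<rparr>"

definition isomorphism ::
  "'i signature \<Rightarrow> ('a \<Rightarrow> 'b) \<Rightarrow> ('i, 'a) rel_structure \<Rightarrow> ('i, 'b) rel_structure \<Rightarrow> bool" where
  "isomorphism \<sigma> f S T \<longleftrightarrow>
     bij_betw f (base_set S) (base_set T) \<and>
     (\<forall>i\<in>symbols \<sigma>. \<forall>xs\<in>tuples (arity \<sigma> i) (base_set S). xs \<in> rels S i \<longleftrightarrow> map f xs \<in> rels T i)"

definition isomorphic ::
  "'i signature \<Rightarrow> ('i, 'a) rel_structure \<Rightarrow> ('i, 'b) rel_structure \<Rightarrow> bool" where
  "isomorphic \<sigma> S T \<longleftrightarrow> (\<exists>f. isomorphism \<sigma> f S T)"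

definition embeds ::
  "'i signature \<Rightarrow> ('i, 'a) rel_structure \<Rightarrow> ('i, 'b) rel_structure \<Rightarrow> bool" where
  "embeds \<sigma> S R \<longleftrightarrow> (\<exists>A\<subseteq>base_set R. isomorphic \<sigma> S (induced R A))"

text \<open>Partial maps are given by a total function together with its intended domain \<open>A\<close>.\<close>

definition local_isomorphism ::
  "'i signature \<Rightarrow> ('i, 'a) rel_structure \<Rightarrow> 'a set \<Rightarrow> ('a \<Rightarrow> 'a) \<Rightarrow> bool" where
  "local_isomorphism \<sigma> R A f \<longleftrightarrow>
     A \<subseteq> base_set R \<and> f ` A \<subseteq> base_set R \<and> isomorphism \<sigma> f (induced R A) (induced R (f ` A))"

definition order_local_isomorphism ::
  "'l set \<Rightarrow> ('l \<times> 'l) set \<Rightarrow> 'l set \<Rightarrow> ('l \<Rightarrow> 'l) \<Rightarrow> bool" where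
  "order_local_isomorphism L r A f \<longleftrightarrow>
     A \<subseteq> L \<and> f ` A \<subseteq> L \<and> inj_on f A \<and>
     (\<forall>y\<in>A. \<forall>y'\<in>A. (y, y') \<in> r \<longleftrightarrow> (f y, f y') \<in> r)"

text \<open>The map sending \<open>a (x, y)\<close> to \<open>a (x, f y)\<close> and fixing \<open>F\<close> pointwise.\<close>

definition lift_map ::
  "'a set \<Rightarrow> 'v set \<Rightarrow> 'l set \<Rightarrow> ('v \<times> 'l \<Rightarrow> 'a) \<Rightarrow> ('l \<Rightarrow> 'l) \<Rightarrow> 'a \<Rightarrow> 'a" where
  "lift_map F V L a f z =
     (if z \<in> F then z else (case inv_into (V \<times> L) a z of (x, y) \<Rightarrow> a (x, f y)))"

text \<open>HOL cannot quantify over the types of the index sets \<open>V\<close> and \<open>L\<close> inside a formula, so these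
  types are parameters of the predicate; a theorem assuming it for type variables \<open>'v\<close> and \<open>'l\<close>
  covers arbitrary \<open>V\<close> and \<open>L\<close>.\<close>

definition almost_multichainable ::
  "'v itself \<Rightarrow> 'l itself \<Rightarrow> 'i signature \<Rightarrow> ('i, 'a) rel_structure \<Rightarrow> bool" where
  "almost_multichainable _ _ \<sigma> R \<longleftrightarrow>
     (\<exists>(F :: 'a set) (V :: 'v set) (L :: 'l set) r a.
        F \<subseteq> base_set R \<and> finite F \<and> finite V \<and> linear_order_on L r \<and>
        bij_betw a (V \<times> L) (base_set R - F) \<and>
        (\<forall>A f. order_local_isomorphism L r A f \<longrightarrow>
           local_isomorphism \<sigma> R (F \<union> a ` (V \<times> A)) (lift_map F V L a f)))"

definition is_bound ::
  "'i signature \<Rightarrow> ('i, 'a) rel_structure \<Rightarrow> ('i, 'b) rel_structure \<Rightarrow> bool" where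
  "is_bound \<sigma> R S \<longleftrightarrow>
     is_structure \<sigma> S \<and> finite (base_set S) \<and> \<not> embeds \<sigma> S R \<and>
     (\<forall>x\<in>base_set S. embeds \<sigma> (induced S (base_set S - {x})) R)"

definition isomorphism_relation ::
  "'i signature \<Rightarrow> (('i, 'b) rel_structure \<times> ('i, 'b) rel_structure) set" where
  "isomorphism_relation \<sigma> =
     {(S, T). is_structure \<sigma> S \<and> is_structure \<sigma> T \<and> isomorphic \<sigma> S T}"

lemma isomorphism_refl: "isomorphism \<sigma> id S S"
  by (simp add: isomorphism_def)

lemma map_in_tuples:
  "bij_betw f A B \<Longrightarrow> xs \<in> tuples m A \<Longrightarrow> map f xs \<in> tuples m B"
  by (auto simp: tuples_def bij_betw_def)

lemma isomorphism_sym: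
  assumes "isomorphism \<sigma> f S T"
  shows "isomorphism \<sigma> (inv_into (base_set S) f) T S"
proof -
  let ?g = "inv_into (base_set S) f"
  have f: "bij_betw f (base_set S) (base_set T)" using assms by (simp add: isomorphism_def)
  have g: "bij_betw ?g (base_set T) (base_set S)" using f by (rule bij_betw_inv_into)
  have "ys \<in> rels T i \<longleftrightarrow> map ?g ys \<in> rels S i"
    if "i \<in> symbols \<sigma>" and ys: "ys \<in> tuples (arity \<sigma> i) (base_set T)" for i ys
  proof -
    have "map f (map ?g ys) = ys"
      using ys f by (auto simp: tuples_def bij_betw_def f_inv_into_f subset_iff intro!: map_idI)
    moreover have "map ?g ys \<in> tuples (arity \<sigma> i) (base_set S)"
      using g ys by (rule map_in_tuples)
    ultimately show ?thesis
      using assms that(1) unfolding isomorphism_def by metis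
  qed
  then show ?thesis using g by (simp add: isomorphism_def)
qed

lemma isomorphism_trans:
  assumes "isomorphism \<sigma> f S T" and "isomorphism \<sigma> g T U"
  shows "isomorphism \<sigma> (g \<circ> f) S U"
  unfolding isomorphism_def
proof (intro conjI ballI)
  show "bij_betw (g \<circ> f) (base_set S) (base_set U)"
    using assms bij_betw_trans unfolding isomorphism_def by blast
  fix i xs assume i: "i \<in> symbols \<sigma>" and xs: "xs \<in> tuples (arity \<sigma> i) (base_set S)"
  have "map f xs \<in> tuples (arity \<sigma> i) (base_set T)"
    using assms(1) xs by (auto simp: isomorphism_def intro: map_in_tuples)
  then have "map f xs \<in> rels T i \<longleftrightarrow> map g (map f xs) \<in> rels U i"
    using assms(2) i unfolding isomorphism_def by blast
  then show "xs \<in> rels S i \<longleftrightarrow> map (g \<circ> f) xs \<in> rels U i"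
    using assms(1) i xs by (simp add: isomorphism_def)
qed

lemma equiv_isomorphism_relation:
  "equiv {S. is_structure \<sigma> S} (isomorphism_relation \<sigma>)"
proof (rule equivI)
  show "refl_on {S. is_structure \<sigma> S} (isomorphism_relation \<sigma>)"
    using isomorphism_refl by (force simp: refl_on_def isomorphism_relation_def isomorphic_def)
  show "sym (isomorphism_relation \<sigma>)"
    by (auto simp: sym_def isomorphism_relation_def isomorphic_def dest: isomorphism_sym)
  show "trans (isomorphism_relation \<sigma>)"
    by (auto simp: trans_def isomorphism_relation_def isomorphic_def dest: isomorphism_trans)
  show "isomorphism_relation \<sigma> \<subseteq> {S. is_structure \<sigma> S} \<times> {S. is_structure \<sigma> S}"
    by (auto simp: isomorphism_relation_def)
qed

end

(*
Bounds form an antichain under embedding, so it suffices to find an embedding between two members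
of any infinite sequence of large bounds S. Every S - x is described by a word over a finite
alphabet (the letters being subsets of F and V, the positions elements of L), but the words for
different x need not be coherent. For m bounding the arities, pick m + 1 points y_i and words w_i
for S - y_i with as many levels as possible; every tuple avoids some y_i. Only boundedly many
levels of w_i ("pivots") create new scattered patterns of length at most m, and replacing the rest
of a tuple by pivots shows that the relations on S - y_i depend on w_i only through the order
relative to the pivots and the isomorphism types of pairs of levels over the pivots. These types
can be read off from one further word, for S - y, if each of its elements is labelled by the type
of its w_i-levels over the pivots, the w_i-levels of y, and y. Higman's lemma for the labelled
words therefore gives the embedding.
*)

theory Submission
  imports Defs "HOL-Library.Sublist" "HOL-Library.Infinite_Set"
begin

section \<open>Higman's lemma over a finite alphabet\<close>

text \<open>Higman's lemma gives one map per word, and maps obtained from two words of the same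
  structure need not agree. So only one word is compared by Higman's lemma, and the other
  \<open>m + 1\<close> are compressed to finitely many labels on its elements. Their orders of
  levels do not compress; this is harmless, since the order of two levels not separated by a pivot
  may change without changing relations, once pairs of levels are under control. Equality of levels
  does not compress either. Here maximality helps: a map that tears a level apart but keeps all
  relations between that level and the pivots would yield a representation with more levels.
  Relations are known to be kept only for tuples avoiding the point \<open>y\<close> that is missing
  from the compared word. Hence \<open>y\<close> must lie off the pivot levels of all
  \<open>m + 1\<close> representations. Finding such a \<open>y\<close> costs the size threshold
  \<open>Suc m * Suc pivot_bound\<close>, below which structures are simply counted. Tuples through
  \<open>y\<close> meet at most one further level besides pivots once two levels are in play, so one
  table per level suffices for them.\<close>

definition bad_sequence :: "'x set \<Rightarrow> (nat \<Rightarrow> 'x list) \<Rightarrow> bool" where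
  "bad_sequence A w \<longleftrightarrow> (\<forall>n. set (w n) \<subseteq> A) \<and> (\<forall>i j. i < j \<longrightarrow> \<not> subseq (w i) (w j))"

text \<open>The minimal bad sequence of Nash-Williams: a prefix of some bad sequence is prolonged by
  a shortest word that leaves it a prefix of some bad sequence.\<close>

lemma minimal_bad_sequence:
  assumes "bad_sequence A w"
  obtains g where "bad_sequence A g"
    and "\<And>n v. bad_sequence A v \<Longrightarrow> (\<And>i. i < n \<Longrightarrow> v i = g i) \<Longrightarrow> length (g n) \<le> length (v n)"
proof -
  define ext where "ext xs \<longleftrightarrow> (\<exists>v. bad_sequence A v \<and> (\<forall>i<length xs. v i = xs ! i))" for xs
  have "\<exists>x. ext (xs @ [x]) \<and> (\<forall>x'. ext (xs @ [x']) \<longrightarrow> length x \<le> length x')" if "ext xs" for xs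
  proof -
    from that obtain v where v: "bad_sequence A v" "\<forall>i<length xs. v i = xs ! i"
      unfolding ext_def by blast
    then have "ext (xs @ [v (length xs)])"
      unfolding ext_def by (auto simp: nth_append less_Suc_eq intro!: exI[of _ v])
    then show ?thesis by (rule ex_has_least_nat)
  qed
  then obtain nx where nx: "\<And>xs. ext xs \<Longrightarrow> ext (xs @ [nx xs])"
      "\<And>xs x'. ext xs \<Longrightarrow> ext (xs @ [x']) \<Longrightarrow> length (nx xs) \<le> length x'"
    by metis
  define pre where "pre n = ((\<lambda>xs. xs @ [nx xs]) ^^ n) []" for n
  define g where "g n = nx (pre n)" for n
  have pre: "pre n = map g [0..<n]" for n
    by (induction n) (auto simp: pre_def g_def)
  have ext: "ext (pre n)" for n
    using assms by (induction n) (auto simp: pre_def ext_def[of "[]"] intro: nx(1))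
  show thesis
  proof
    \<comment> \<open>Badness concerns two indices at a time, so it can be checked on finite
      prefixes, each of which extends to a bad sequence.\<close>
    show "bad_sequence A g"
      unfolding bad_sequence_def
    proof (intro conjI allI impI)
      fix n
      obtain v where "bad_sequence A v" "\<forall>i<Suc n. v i = g i"
        using ext[of "Suc n"] unfolding ext_def pre by (auto simp del: upt_Suc)
      then show "set (g n) \<subseteq> A" unfolding bad_sequence_def by (metis lessI)
    next
      fix i j :: nat assume "i < j"
      obtain v where "bad_sequence A v" "\<forall>i<Suc j. v i = g i"
        using ext[of "Suc j"] unfolding ext_def pre by (auto simp del: upt_Suc)
      then show "\<not> subseq (g i) (g j)"
        using \<open>i < j\<close> unfolding bad_sequence_def by (metis lessI less_SucI)
    qed
  next
    fix n v assume "bad_sequence A v" "\<And>i. i < n \<Longrightarrow> v i = g i"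
    then have "ext (pre n @ [v n])"
      unfolding ext_def pre by (auto simp: nth_append less_Suc_eq intro!: exI[of _ v])
    then show "length (g n) \<le> length (v n)"
      unfolding g_def using nx(2) ext by blast
  qed
qed

text \<open>Over a finite alphabet the pigeonhole principle provides infinitely many words with the
  same first letter; deleting that letter keeps a minimal bad sequence bad and makes it
  smaller.\<close>

theorem higman_finite_alphabet:
  assumes "finite A" and "\<And>n. set (w n) \<subseteq> A"
  shows "\<exists>i j. i < (j::nat) \<and> subseq (w i) (w j)"
proof (rule ccontr)
  assume "\<not> ?thesis"
  then have "bad_sequence A w" using assms(2) by (auto simp: bad_sequence_def)
  then obtain g where g: "bad_sequence A g" and
    gmin: "\<And>n v. bad_sequence A v \<Longrightarrow> (\<And>i. i < n \<Longrightarrow> v i = g i) \<Longrightarrow> length (g n) \<le> length (v n)"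
    using minimal_bad_sequence by blast
  have gA: "set (g n) \<subseteq> A" for n using g by (auto simp: bad_sequence_def)
  have gb: "\<not> subseq (g i) (g j)" if "i < j" for i j using g that by (auto simp: bad_sequence_def)
  have ne: "g n \<noteq> []" for n using gb[of n "Suc n"] by auto
  have "\<exists>a\<in>A. infinite {n \<in> UNIV. hd (g n) = a}"
    using assms(1) gA hd_in_set[OF ne] by (intro pigeonhole_infinite_rel) auto
  then obtain a where inf: "infinite {n. hd (g n) = a}" by auto
  define e where "e = enumerate {n. hd (g n) = a}"
  have e: "strict_mono e" and hd: "hd (g (e n)) = a" for n
    using strict_mono_enumerate[OF inf] enumerate_in_set[OF inf] by (auto simp: e_def)
  \<comment> \<open>Keeping \<open>g\<close> unchanged before \<open>e 0\<close> makes minimality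
    applicable at index \<open>e 0\<close>, where \<open>h\<close> has a word shorter by one
    letter.\<close>
  define h where "h n = (if n < e 0 then g n else tl (g (e (n - e 0))))" for n
  have cons: "g (e n) = a # tl (g (e n))" for n using hd[of n] ne[of "e n"] by (cases "g (e n)") auto
  have "bad_sequence A h"
    unfolding bad_sequence_def
  proof (intro conjI allI impI)
    fix n
    have "set (tl (g j)) \<subseteq> A" for j using gA[of j] ne[of j] by (cases "g j") auto
    then show "set (h n) \<subseteq> A" using gA by (simp add: h_def)
  next
    fix i j :: nat assume ij: "i < j"
    consider "j < e 0" | "i < e 0" "e 0 \<le> j" | "e 0 \<le> i" by linarith
    then show "\<not> subseq (h i) (h j)"
    proof cases
      case 1 then show ?thesis using ij gb by (simp add: h_def)
    next
      case 2
      have "e 0 \<le> e (j - e 0)" using e by (simp add: strict_mono_less_eq)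
      then have "\<not> subseq (g i) (a # tl (g (e (j - e 0))))" using 2 gb cons by simp
      then show ?thesis using 2 by (auto simp: h_def)
    next
      case 3
      then have "e (i - e 0) < e (j - e 0)" using e ij by (simp add: strict_mono_less)
      then have "\<not> subseq (g (e (i - e 0))) (g (e (j - e 0)))" by (rule gb)
      then have "\<not> subseq (a # tl (g (e (i - e 0)))) (a # tl (g (e (j - e 0))))" using cons by simp
      then show ?thesis using 3 ij by (simp add: h_def)
    qed
  qed
  then have "length (g (e 0)) \<le> length (h (e 0))"
    by (rule gmin) (simp add: h_def)
  then show False using ne[of "e 0"] by (cases "g (e 0)") (auto simp: h_def)
qed

lemma subseq_index_map:
  assumes "subseq xs ys"
  shows "\<exists>p. (\<forall>j<length xs. p j < length ys \<and> xs ! j = ys ! p j) \<and>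
    (\<forall>i j. i < j \<longrightarrow> j < length xs \<longrightarrow> p i < (p j::nat))"
  using assms
proof (induction rule: list_emb.induct)
  case (list_emb_Nil ys)
  then show ?case by simp
next
  case (list_emb_Cons xs ys y)
  then obtain p where "(\<forall>j<length xs. p j < length ys \<and> xs ! j = ys ! p j)"
    "(\<forall>i j. i < j \<longrightarrow> j < length xs \<longrightarrow> p i < (p j::nat))" by blast
  then show ?case by (intro exI[of _ "\<lambda>j. Suc (p j)"]) auto
next
  case (list_emb_Cons2 x y xs ys)
  then obtain p where "(\<forall>j<length xs. p j < length ys \<and> xs ! j = ys ! p j)"
    "(\<forall>i j. i < j \<longrightarrow> j < length xs \<longrightarrow> p i < (p j::nat))" by blast
  with list_emb_Cons2 show ?case
    by (intro exI[of _ "\<lambda>j. case j of 0 \<Rightarrow> 0 | Suc j \<Rightarrow> Suc (p j)"])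
      (auto split: nat.splits simp: nth_Cons)
qed

text \<open>Representatives of infinitely many classes would form a sequence of pairwise
  inequivalent elements.\<close>

lemma finite_quotient_if_good:
  assumes eq: "equiv B r" and sub: "X \<subseteq> B"
    and good: "\<And>s. (\<And>n::nat. s n \<in> X) \<Longrightarrow> \<exists>i j. i \<noteq> j \<and> (s i, s j) \<in> r"
  shows "finite (X // r)"
proof (rule ccontr)
  assume "infinite (X // r)"
  then obtain q :: "nat \<Rightarrow> _" where q: "inj q" "range q \<subseteq> X // r"
    using infinite_countable_subset by blast
  have "\<forall>n. \<exists>x\<in>X. q n = r `` {x}" using q(2) by (auto simp: quotient_def)
  then obtain s where s: "\<And>n. s n \<in> X" "\<And>n. q n = r `` {s n}" by metis
  from good[OF s(1)] obtain i j where "i \<noteq> j" "(s i, s j) \<in> r" by blast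
  then have "q i = q j" using s equiv_class_eq[OF eq] by metis
  with \<open>i \<noteq> j\<close> q(1) show False by (auto dest: injD)
qed

section \<open>Scattered patterns of a word\<close>

definition patterns :: "nat \<Rightarrow> (nat \<Rightarrow> 'x) \<Rightarrow> nat set \<Rightarrow> 'x list set" where
  "patterns m b A = {map b ns | ns. sorted_wrt (<) ns \<and> set ns \<subseteq> A \<and> length ns \<le> m}"

lemma patterns_mono: "A \<subseteq> B \<Longrightarrow> patterns m b A \<subseteq> patterns m b B"
  by (auto simp: patterns_def)

lemma patterns_snoc:
  assumes "p \<in> patterns m b (A \<inter> {..<n})" and "n \<in> A" and "length p < m"
  shows "p @ [b n] \<in> patterns m b (A \<inter> {..<Suc n})"
proof -
  from assms(1) obtain ns where ns: "p = map b ns" "sorted_wrt (<) ns" "set ns \<subseteq> A \<inter> {..<n}"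
    by (auto simp: patterns_def)
  have "sorted_wrt (<) (ns @ [n])" using ns by (auto simp: sorted_wrt_append)
  then show ?thesis
    using ns assms(2,3) unfolding patterns_def
    by (intro CollectI exI[of _ "ns @ [n]"]) auto
qed

lemma patterns_Cons:
  assumes "p \<in> patterns m b (A \<inter> {Suc n..})" and "n \<in> A" and "length p < m"
  shows "b n # p \<in> patterns m b (A \<inter> {n..})"
proof -
  from assms(1) obtain ns where ns: "p = map b ns" "sorted_wrt (<) ns" "set ns \<subseteq> A \<inter> {Suc n..}"
    by (auto simp: patterns_def)
  have "sorted_wrt (<) (n # ns)" using ns by auto
  then show ?thesis
    using ns assms(2,3) unfolding patterns_def
    by (intro CollectI exI[of _ "n # ns"]) auto
qed

text \<open>Below an unstable level some short pattern occurs for the first time, or above it for the last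
  time. Hence every short pattern occurring below (above) a level is already realised by unstable
  levels below (above) it.\<close>

definition unstable :: "nat \<Rightarrow> (nat \<Rightarrow> 'x) \<Rightarrow> nat set \<Rightarrow> nat set" where
  "unstable m b A = {n. patterns m b (A \<inter> {..<Suc n}) \<noteq> patterns m b (A \<inter> {..<n}) \<or>
                        patterns m b (A \<inter> {n..}) \<noteq> patterns m b (A \<inter> {Suc n..})}"

lemma unstable_subset: "unstable m b A \<subseteq> A"
proof
  fix n assume n: "n \<in> unstable m b A"
  show "n \<in> A"
  proof (rule ccontr)
    assume "n \<notin> A"
    then have "A \<inter> {..<Suc n} = A \<inter> {..<n}" "A \<inter> {n..} = A \<inter> {Suc n..}"
      by (auto simp: less_Suc_eq Suc_le_eq le_less)
    with n show False by (simp add: unstable_def)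
  qed
qed

text \<open>Each strict step has a new element as witness. No element serves twice, because the
  witness of a step belongs to all later sets.\<close>

lemma card_strict_steps:
  fixes X :: "nat \<Rightarrow> 'x set"
  assumes X: "\<And>i j. i \<le> j \<Longrightarrow> X i \<subseteq> X j" "\<And>n. X n \<subseteq> Q" and Q: "finite Q"
  shows "finite {n. X (Suc n) \<noteq> X n} \<and> card {n. X (Suc n) \<noteq> X n} \<le> card Q"
proof -
  let ?D = "{n. X (Suc n) \<noteq> X n}"
  have "\<forall>n\<in>?D. \<exists>p. p \<in> X (Suc n) - X n" using X(1)[OF le_SucI[OF order_refl]] by blast
  then obtain p where p: "\<And>n. n \<in> ?D \<Longrightarrow> p n \<in> X (Suc n) - X n" by metis
  have "inj_on p ?D"
  proof (rule linorder_inj_onI')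
    fix i j assume "i \<in> ?D" "j \<in> ?D" "i < j"
    then have "p i \<in> X j" "p j \<notin> X j" using p X(1)[of "Suc i" j] by auto
    then show "p i \<noteq> p j" by auto
  qed
  moreover have "p ` ?D \<subseteq> Q" using p X(2) by blast
  ultimately show ?thesis using Q card_inj_on_le finite_imageD finite_subset by metis
qed

lemma card_strict_steps_down:
  fixes X :: "nat \<Rightarrow> 'x set"
  assumes X: "\<And>i j. i \<le> j \<Longrightarrow> X j \<subseteq> X i" "\<And>n. X n \<subseteq> Q" and Q: "finite Q"
  shows "finite {n. X n \<noteq> X (Suc n)} \<and> card {n. X n \<noteq> X (Suc n)} \<le> card Q"
proof -
  have "{n. X n \<noteq> X (Suc n)} = {n. Q - X (Suc n) \<noteq> Q - X n}" using X(2) by (auto simp: set_eq_iff)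
  moreover have "finite {n. Q - X (Suc n) \<noteq> Q - X n} \<and> card {n. Q - X (Suc n) \<noteq> Q - X n} \<le> card Q"
    using Q X(1) by (intro card_strict_steps) auto
  ultimately show ?thesis by simp
qed

text \<open>Patterns below a level form an increasing chain and patterns above it a decreasing one,
  both inside the same finite set of short words; hence the factor 2.\<close>

lemma card_unstable:
  assumes B: "finite B" and "b ` A \<subseteq> B"
  shows "finite (unstable m b A)"
    and "card (unstable m b A) \<le> 2 * card {p. set p \<subseteq> B \<and> length p \<le> m}"
proof -
  let ?Q = "{p. set p \<subseteq> B \<and> length p \<le> m}"
  let ?P = "\<lambda>n. patterns m b (A \<inter> {..<n})" and ?S = "\<lambda>n. patterns m b (A \<inter> {n..})"
  have Q: "finite ?Q" using B by (rule finite_lists_length_le)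
  have sub: "patterns m b A' \<subseteq> ?Q" if "A' \<subseteq> A" for A'
    using assms(2) that by (fastforce simp: patterns_def)
  have 1: "finite {n. ?P (Suc n) \<noteq> ?P n} \<and> card {n. ?P (Suc n) \<noteq> ?P n} \<le> card ?Q"
    using Q sub by (intro card_strict_steps patterns_mono) auto
  have 2: "finite {n. ?S n \<noteq> ?S (Suc n)} \<and> card {n. ?S n \<noteq> ?S (Suc n)} \<le> card ?Q"
    using Q sub by (intro card_strict_steps_down patterns_mono) auto
  have U: "unstable m b A = {n. ?P (Suc n) \<noteq> ?P n} \<union> {n. ?S n \<noteq> ?S (Suc n)}"
    by (auto simp: unstable_def)
  show "finite (unstable m b A)" using 1 2 U by simp
  show "card (unstable m b A) \<le> 2 * card ?Q"
    unfolding U using 1 2 card_Un_le[of "{n. ?P (Suc n) \<noteq> ?P n}" "{n. ?S n \<noteq> ?S (Suc n)}"] by linarith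
qed

text \<open>If the topmost level is stable, the pattern already occurs below it. If it is unstable
  and used, it is kept as the last level and the shorter pattern before it is handled by
  induction.\<close>

lemma pattern_below_unstable:
  assumes "p \<in> patterns m b (A \<inter> {..<n})"
  shows "\<exists>ns. sorted_wrt (<) ns \<and> set ns \<subseteq> unstable m b A \<inter> {..<n} \<and> p = map b ns"
  using assms
proof (induction n arbitrary: p)
  case 0
  then show ?case by (auto simp: patterns_def)
next
  case (Suc n)
  have old: ?case if *: "p \<in> patterns m b (A \<inter> {..<n})"
  proof -
    obtain ns where "sorted_wrt (<) ns" "set ns \<subseteq> unstable m b A \<inter> {..<n}" "p = map b ns"
      using Suc.IH[OF *] by blast
    then show ?thesis by (intro exI[of _ ns]) auto
  qed
  show ?case
  proof (cases "n \<in> unstable m b A")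
    case False
    then show ?thesis using Suc.prems old by (simp add: unstable_def)
  next
    case True
    from Suc.prems obtain ns where ns: "p = map b ns" "sorted_wrt (<) ns"
      "set ns \<subseteq> A \<inter> {..<Suc n}" "length ns \<le> m" by (auto simp: patterns_def)
    show ?thesis
    proof (cases "n \<in> set ns")
      case False
      then have "set ns \<subseteq> A \<inter> {..<n}" using ns(3) by (auto simp: less_Suc_eq)
      then show ?thesis using ns old by (auto simp: patterns_def)
    next
      case n: True
      then obtain xs ys where split: "ns = xs @ n # ys" by (meson split_list)
      have "ys = []" using ns(2,3) split by (cases ys) (auto simp: sorted_wrt_append)
      then have xs: "ns = xs @ [n]" using split by simp
      have "map b xs \<in> patterns m b (A \<inter> {..<n})"
        using ns xs by (auto simp: patterns_def sorted_wrt_append)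
      from Suc.IH[OF this] obtain us where us: "sorted_wrt (<) us"
        "set us \<subseteq> unstable m b A \<inter> {..<n}" "map b xs = map b us" by blast
      then show ?thesis
        using True ns(1) xs by (intro exI[of _ "us @ [n]"]) (auto simp: sorted_wrt_append)
    qed
  qed
qed

text \<open>The mirror image, by downward induction; finiteness of \<open>A\<close> supplies a level
  \<open>N\<close> above which nothing lies and where the induction starts.\<close>

lemma pattern_above_unstable:
  assumes "finite A" and "p \<in> patterns m b (A \<inter> {n..})"
  shows "\<exists>ns. sorted_wrt (<) ns \<and> set ns \<subseteq> unstable m b A \<inter> {n..} \<and> p = map b ns"
proof -
  obtain N where N: "A \<subseteq> {..<N}" using assms(1) by (metis finite_nat_iff_bounded)
  have nil: "\<exists>ns. sorted_wrt (<) ns \<and> set ns \<subseteq> unstable m b A \<inter> {n..} \<and> p = map b ns"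
    if "n \<ge> N" "p \<in> patterns m b (A \<inter> {n..})" for n p
  proof -
    have "A \<inter> {n..} = {}" using N that(1) by force
    then show ?thesis using that(2) by (auto simp: patterns_def)
  qed
  show ?thesis
  proof (cases "n \<le> N")
    case False
    then show ?thesis using nil assms(2) by simp
  next
    case True
    then show ?thesis using assms(2)
    proof (induction n arbitrary: p rule: inc_induct)
      case base
      then show ?case using nil by simp
    next
      case (step n)
      have old: ?case if *: "p \<in> patterns m b (A \<inter> {Suc n..})"
      proof -
        obtain ns where "sorted_wrt (<) ns" "set ns \<subseteq> unstable m b A \<inter> {Suc n..}" "p = map b ns"
          using step.IH[OF *] by blast
        then show ?thesis by (intro exI[of _ ns]) auto
      qed
      show ?case
      proof (cases "n \<in> unstable m b A")
        case False
        then show ?thesis using step.prems old by (simp add: unstable_def)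
      next
        case True
        from step.prems obtain ns where ns: "p = map b ns" "sorted_wrt (<) ns"
          "set ns \<subseteq> A \<inter> {n..}" "length ns \<le> m" by (auto simp: patterns_def)
        show ?thesis
        proof (cases "n \<in> set ns")
          case False
          then have "set ns \<subseteq> A \<inter> {Suc n..}" using ns(3) by (force simp: Suc_le_eq intro: order_le_neq_trans)
          then show ?thesis using ns old by (auto simp: patterns_def)
        next
          case n: True
          then obtain xs ys where split: "ns = xs @ n # ys" by (meson split_list)
          have "xs = []" using ns(2,3) split by (cases xs) (auto simp: sorted_wrt_append)
          then have ys: "ns = n # ys" using split by simp
          have "map b ys \<in> patterns m b (A \<inter> {Suc n..})"
            using ns ys by (auto simp: patterns_def Suc_le_eq intro!: exI[of _ ys])
          from step.IH[OF this] obtain us where us: "sorted_wrt (<) us"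
            "set us \<subseteq> unstable m b A \<inter> {Suc n..}" "map b ys = map b us" by blast
          then show ?thesis
            using True ns(1) ys by (intro exI[of _ "n # us"]) (auto simp: Suc_le_eq)
        qed
      qed
    qed
  qed
qed

text \<open>The constraint on the order of two levels that is imposed by keeping all levels fixed relative to
  those in \<open>U\<close>.\<close>

definition may_precede :: "nat set \<Rightarrow> nat \<Rightarrow> nat \<Rightarrow> bool" where
  "may_precede U x y \<longleftrightarrow> (\<forall>u\<in>U. \<not> (y \<le> u \<and> u \<le> x))"

lemma patterns_below_eq:
  assumes "i \<le> j" and "\<And>n. i \<le> n \<Longrightarrow> n < j \<Longrightarrow> n \<notin> unstable m b A"
  shows "patterns m b (A \<inter> {..<j}) = patterns m b (A \<inter> {..<i})"
  using assms by (induction j rule: dec_induct) (simp_all add: unstable_def)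

lemma patterns_above_eq:
  assumes "i \<le> j" and "\<And>n. i \<le> n \<Longrightarrow> n < j \<Longrightarrow> n \<notin> unstable m b A"
  shows "patterns m b (A \<inter> {j..}) = patterns m b (A \<inter> {i..})"
  using assms by (induction j rule: dec_induct) (simp_all add: unstable_def)

text \<open>Between unstable levels, appending a block never creates a new pattern. So even a rearranged
  sequence of levels, as long as it respects the unstable ones, only shows patterns that occur in
  the original order.\<close>

lemma arrangement_pattern_below:
  assumes "sorted_wrt (may_precede (unstable m b A)) (ps @ [a])" "set ps \<subseteq> A" "length ps \<le> m"
  shows "map b ps \<in> patterns m b (A \<inter> {..<a})"
  using assms
proof (induction ps arbitrary: a rule: rev_induct)
  case Nil
  then show ?case by (auto simp: patterns_def)
next
  case (snoc k ps)
  have k: "may_precede (unstable m b A) k a" using snoc.prems(1) by (simp add: sorted_wrt_append)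
  have "map b ps \<in> patterns m b (A \<inter> {..<k})"
    using snoc.prems by (intro snoc.IH) (auto simp: sorted_wrt_append)
  then have *: "map b ps @ [b k] \<in> patterns m b (A \<inter> {..<Suc k})"
    using snoc.prems by (intro patterns_snoc) auto
  show ?case
  proof (cases "k < a")
    case True
    then have "patterns m b (A \<inter> {..<Suc k}) \<subseteq> patterns m b (A \<inter> {..<a})"
      by (intro patterns_mono) auto
    then show ?thesis using * by auto
  next
    \<comment> \<open>Now \<open>a\<close> \<le> \<open>k\<close>, and \<open>may_precede\<close>
      leaves no unstable level from \<open>a\<close> to \<open>k\<close> inclusive, so moving back
      from \<open>Suc k\<close> to \<open>a\<close> loses no pattern.\<close>
    case False
    then have "patterns m b (A \<inter> {..<Suc k}) = patterns m b (A \<inter> {..<a})"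
      using k by (intro patterns_below_eq) (auto simp: may_precede_def)
    then show ?thesis using * by simp
  qed
qed

lemma arrangement_pattern_above:
  assumes "sorted_wrt (may_precede (unstable m b A)) (a # qs)" "set qs \<subseteq> A" "length qs \<le> m"
  shows "map b qs \<in> patterns m b (A \<inter> {Suc a..})"
  using assms
proof (induction qs arbitrary: a)
  case Nil
  then show ?case by (auto simp: patterns_def)
next
  case (Cons k qs)
  have k: "may_precede (unstable m b A) a k" using Cons.prems(1) by simp
  have "map b qs \<in> patterns m b (A \<inter> {Suc k..})"
    using Cons.prems by (intro Cons.IH) auto
  then have *: "b k # map b qs \<in> patterns m b (A \<inter> {k..})"
    using Cons.prems by (intro patterns_Cons) auto
  show ?case
  proof (cases "a < k")
    case True
    then have "patterns m b (A \<inter> {k..}) \<subseteq> patterns m b (A \<inter> {Suc a..})"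
      by (intro patterns_mono) auto
    then show ?thesis using * by auto
  next
    case False
    then have "patterns m b (A \<inter> {Suc a..}) = patterns m b (A \<inter> {k..})"
      using k by (intro patterns_above_eq) (auto simp: may_precede_def)
    then show ?thesis using * by simp
  qed
qed

section \<open>Rearranging levels\<close>

text \<open>Positions in a list of levels serve as new levels, so every stage of a sorting process
  is itself an assignment of levels.\<close>

definition pos :: "nat list \<Rightarrow> nat \<Rightarrow> nat" where
  "pos ks n = length (takeWhile (\<lambda>x. x \<noteq> n) ks)"

lemma pos_append: "pos (ps @ qs) n = (if n \<in> set ps then pos ps n else length ps + pos qs n)"
  by (induction ps) (auto simp: pos_def)

lemma pos_Cons: "pos (p # ps) n = (if n = p then 0 else Suc (pos ps n))"
  by (auto simp: pos_def)

lemma pos_less_length: "n \<in> set ks \<Longrightarrow> pos ks n < length ks"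
  by (induction ks) (auto simp: pos_Cons)

lemma nth_pos: "n \<in> set ks \<Longrightarrow> ks ! pos ks n = n"
  by (induction ks) (auto simp: pos_Cons)

lemma pos_inject: "x \<in> set ks \<Longrightarrow> y \<in> set ks \<Longrightarrow> pos ks x = pos ks y \<longleftrightarrow> x = y"
  by (metis nth_pos)

lemma pos_less_sorted:
  assumes "sorted_wrt (\<lambda>x y. d x < (d y :: nat)) ks" "x \<in> set ks" "y \<in> set ks"
  shows "pos ks x < pos ks y \<longleftrightarrow> d x < d y"
proof -
  have *: "d x < d y" if "pos ks x < pos ks y" "x \<in> set ks" "y \<in> set ks" for x y
    using sorted_wrt_nth_less[OF assms(1) that(1)] that by (simp add: nth_pos pos_less_length)
  show ?thesis
    using *[of x y] *[of y x] assms(2,3) pos_inject[of x ks y] by (metis less_asym' linorder_neqE_nat)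
qed

text \<open>Here \<open>u\<close> and \<open>v\<close> are two neighbours in a list of levels and
  \<open>g\<close> is an order to be matched. It serves both sides of a swap: \<open>g\<close> comes
  from the true levels before it and from the target levels after it.\<close>

lemma pos_less_four_parts:
  fixes g l :: "'b \<Rightarrow> nat"
  assumes "\<And>x y. x \<in> X \<Longrightarrow> y \<in> X \<Longrightarrow> l x \<in> set ps \<Longrightarrow> l y \<in> set ps \<Longrightarrow>
      g x < g y \<longleftrightarrow> pos ps (l x) < pos ps (l y)"
    and "\<And>x y. x \<in> X \<Longrightarrow> y \<in> X \<Longrightarrow> l x \<in> set qs \<Longrightarrow> l y \<in> set qs \<Longrightarrow>
      g x < g y \<longleftrightarrow> pos qs (l x) < pos qs (l y)"
    and lo: "\<And>x. x \<in> X \<Longrightarrow> l x \<in> set ps \<Longrightarrow> g x < gu"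
    and hi: "\<And>x. x \<in> X \<Longrightarrow> l x \<in> set qs \<Longrightarrow> gv < g x"
    and "\<And>x. l x = u \<Longrightarrow> g x = gu" "\<And>x. l x = v \<Longrightarrow> g x = gv" and uv: "gu < gv"
    and "distinct (ps @ u # v # qs)" and xy: "x \<in> X" "y \<in> X"
    and lxy: "l x \<in> set (ps @ u # v # qs)" "l y \<in> set (ps @ u # v # qs)"
  shows "pos (ps @ u # v # qs) (l x) < pos (ps @ u # v # qs) (l y) \<longleftrightarrow> g x < g y"
proof -
  have part: "(l z \<in> set ps \<and> pos (ps @ u # v # qs) (l z) = pos ps (l z) \<and> pos ps (l z) < length ps \<and> g z < gu) \<or>
    (l z = u \<and> pos (ps @ u # v # qs) (l z) = length ps \<and> g z = gu) \<or>
    (l z = v \<and> pos (ps @ u # v # qs) (l z) = Suc (length ps) \<and> g z = gv) \<or>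
    (l z \<in> set qs \<and> pos (ps @ u # v # qs) (l z) = length ps + 2 + pos qs (l z) \<and> gv < g z)"
    if "z \<in> X" "l z \<in> set (ps @ u # v # qs)" for z
    using that assms(5,6,8) lo[of z] hi[of z] pos_less_length[of "l z" ps]
    by (auto simp: pos_append pos_Cons)
  from part[OF xy(1) lxy(1)] part[OF xy(2) lxy(2)] assms(1)[OF xy] assms(2)[OF xy] uv
  show ?thesis by (elim disjE conjE) linarith+
qed

text \<open>A pair is a letter with a level. Such order-invariant predicates are all that is kept of
  the ambient structure until the last section.\<close>

locale order_pattern =
  fixes m :: nat and Phi :: "'i \<Rightarrow> (nat \<times> nat) list \<Rightarrow> bool"
  assumes Phi_invariant: "\<And>q xs ys. map fst xs = map fst ys \<Longrightarrow>
    (\<And>i j. i < length xs \<Longrightarrow> j < length xs \<Longrightarrow> snd (xs ! i) < snd (xs ! j) \<longleftrightarrow> snd (ys ! i) < snd (ys ! j))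
    \<Longrightarrow> Phi q xs = Phi q ys"
begin

abbreviation holds :: "'i \<Rightarrow> ('b \<Rightarrow> nat) \<Rightarrow> ('b \<Rightarrow> nat) \<Rightarrow> 'b list \<Rightarrow> bool" where
  "holds q c l xs \<equiv> Phi q (map (\<lambda>x. (c x, l x)) xs)"

lemma holds_cong:
  assumes "\<And>x. x \<in> set xs \<Longrightarrow> c x = c' x"
    and "\<And>x y. x \<in> set xs \<Longrightarrow> y \<in> set xs \<Longrightarrow> l x < l y \<longleftrightarrow> l' x < l' y"
  shows "holds q c l xs = holds q c' l' xs"
  using assms by (intro Phi_invariant) auto

lemma holds_map: "holds q c l (map e xs) = holds q (\<lambda>x. c (e x)) (\<lambda>x. l (e x)) xs"
  by (simp add: comp_def)

text \<open>This set is the letter of the word at level \<open>n\<close>, so \<open>pivots\<close>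
  measures instability over an alphabet of sets of letters.\<close>

definition block :: "'b set \<Rightarrow> ('b \<Rightarrow> nat) \<Rightarrow> ('b \<Rightarrow> nat) \<Rightarrow> nat \<Rightarrow> nat set" where
  "block T c l n = c ` {t \<in> T. l t = n}"

definition pivots :: "'b set \<Rightarrow> ('b \<Rightarrow> nat) \<Rightarrow> ('b \<Rightarrow> nat) \<Rightarrow> nat set" where
  "pivots T c l = unstable m (block T c l) (l ` T)"

lemma pivots_subset: "pivots T c l \<subseteq> l ` T"
  by (simp add: pivots_def unstable_subset)

text \<open>Equal blocks guarantee that an element finds its own letter at the level in the same
  place of \<open>us\<close>. The list \<open>ps\<close> may be unsorted, so the order obtained is
  that of positions in \<open>ps\<close>.\<close>

lemma transport_blocks:
  assumes "map (block T c l) ps = map (block T c l) us" "sorted_wrt (<) us"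
  obtains e where "\<And>t. t \<in> T \<Longrightarrow> l t \<in> set ps \<Longrightarrow> e t \<in> T \<and> c (e t) = c t \<and> l (e t) \<in> set us"
    and "\<And>s t. s \<in> T \<Longrightarrow> t \<in> T \<Longrightarrow> l s \<in> set ps \<Longrightarrow> l t \<in> set ps \<Longrightarrow>
      l (e s) < l (e t) \<longleftrightarrow> pos ps (l s) < pos ps (l t)"
proof -
  have len: "length ps = length us" using assms(1) by (metis length_map)
  have "\<exists>e\<in>T. c e = c t \<and> l e = us ! pos ps (l t)" if t: "t \<in> T" "l t \<in> set ps" for t
  proof -
    have "block T c l (l t) = block T c l (us ! pos ps (l t))"
      using t assms(1) len by (metis nth_map nth_pos pos_less_length)
    then have "c t \<in> block T c l (us ! pos ps (l t))" using t by (auto simp: block_def)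
    then show ?thesis by (auto simp: block_def)
  qed
  then obtain e where e: "\<And>t. t \<in> T \<Longrightarrow> l t \<in> set ps \<Longrightarrow> e t \<in> T \<and> c (e t) = c t \<and> l (e t) = us ! pos ps (l t)"
    by metis
  show thesis
  proof
    show "e t \<in> T \<and> c (e t) = c t \<and> l (e t) \<in> set us" if "t \<in> T" "l t \<in> set ps" for t
      using e[OF that] pos_less_length[OF that(2)] len by simp
    fix s t assume st: "s \<in> T" "t \<in> T" "l s \<in> set ps" "l t \<in> set ps"
    have "us ! i < us ! j \<longleftrightarrow> i < j" if "i < length us" "j < length us" for i j
      using sorted_wrt_nth_less[OF assms(2), of i j] sorted_wrt_nth_less[OF assms(2), of j i] that
      by (metis less_asym' linorder_neqE_nat)
    then show "l (e s) < l (e t) \<longleftrightarrow> pos ps (l s) < pos ps (l t)"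
      using e st by (simp add: pos_less_length len[symmetric])
  qed
qed

text \<open>Two reference levels are needed: in a swap \<open>a\<close> and \<open>a'\<close> are
  the neighbours to be exchanged, whereas for splitting a level they coincide. Levels outside both
  lists stay fixed.\<close>

lemma replace_context:
  assumes T: "finite T"
    and ps: "sorted_wrt (may_precede (pivots T c l)) (ps @ [a])" "set ps \<subseteq> l ` T" "length ps \<le> m"
    and qs: "sorted_wrt (may_precede (pivots T c l)) (a' # qs)" "set qs \<subseteq> l ` T" "length qs \<le> m"
    and disj: "set ps \<inter> set qs = {}"
  obtains e where
    "\<And>t. t \<in> T \<Longrightarrow> l t \<in> set ps \<Longrightarrow> e t \<in> T \<and> c (e t) = c t \<and> l (e t) \<in> pivots T c l \<and> l (e t) < a"
    "\<And>t. t \<in> T \<Longrightarrow> l t \<in> set qs \<Longrightarrow> e t \<in> T \<and> c (e t) = c t \<and> l (e t) \<in> pivots T c l \<and> a' < l (e t)"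
    "\<And>t. l t \<notin> set ps \<Longrightarrow> l t \<notin> set qs \<Longrightarrow> e t = t"
    "\<And>s t. s \<in> T \<Longrightarrow> t \<in> T \<Longrightarrow> l s \<in> set ps \<Longrightarrow> l t \<in> set ps \<Longrightarrow>
      l (e s) < l (e t) \<longleftrightarrow> pos ps (l s) < pos ps (l t)"
    "\<And>s t. s \<in> T \<Longrightarrow> t \<in> T \<Longrightarrow> l s \<in> set qs \<Longrightarrow> l t \<in> set qs \<Longrightarrow>
      l (e s) < l (e t) \<longleftrightarrow> pos qs (l s) < pos qs (l t)"
proof -
  have "map (block T c l) ps \<in> patterns m (block T c l) (l ` T \<inter> {..<a})"
    using ps by (intro arrangement_pattern_below) (simp_all add: pivots_def)
  then obtain us where us: "sorted_wrt (<) us" "set us \<subseteq> pivots T c l \<inter> {..<a}"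
    "map (block T c l) ps = map (block T c l) us"
    using pattern_below_unstable unfolding pivots_def by blast
  have "map (block T c l) qs \<in> patterns m (block T c l) (l ` T \<inter> {Suc a'..})"
    using qs by (intro arrangement_pattern_above) (simp_all add: pivots_def)
  then obtain vs where vs: "sorted_wrt (<) vs" "set vs \<subseteq> pivots T c l \<inter> {Suc a'..}"
    "map (block T c l) qs = map (block T c l) vs"
    using pattern_above_unstable[of "l ` T"] T unfolding pivots_def by blast
  obtain e1 where e1: "\<And>t. t \<in> T \<Longrightarrow> l t \<in> set ps \<Longrightarrow> e1 t \<in> T \<and> c (e1 t) = c t \<and> l (e1 t) \<in> set us"
      "\<And>s t. s \<in> T \<Longrightarrow> t \<in> T \<Longrightarrow> l s \<in> set ps \<Longrightarrow> l t \<in> set ps \<Longrightarrow>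
      l (e1 s) < l (e1 t) \<longleftrightarrow> pos ps (l s) < pos ps (l t)"
    using transport_blocks[OF us(3,1)] by blast
  obtain e2 where e2: "\<And>t. t \<in> T \<Longrightarrow> l t \<in> set qs \<Longrightarrow> e2 t \<in> T \<and> c (e2 t) = c t \<and> l (e2 t) \<in> set vs"
      "\<And>s t. s \<in> T \<Longrightarrow> t \<in> T \<Longrightarrow> l s \<in> set qs \<Longrightarrow> l t \<in> set qs \<Longrightarrow>
      l (e2 s) < l (e2 t) \<longleftrightarrow> pos qs (l s) < pos qs (l t)"
    using transport_blocks[OF vs(3,1)] by blast
  define e where "e t = (if l t \<in> set ps then e1 t else if l t \<in> set qs then e2 t else t)" for t
  have E1: "e t = e1 t" if "l t \<in> set ps" for t using that by (simp add: e_def)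
  have E2: "e t = e2 t" if "l t \<in> set qs" for t using that disj by (auto simp: e_def)
  show thesis
  proof
    show "e t \<in> T \<and> c (e t) = c t \<and> l (e t) \<in> pivots T c l \<and> l (e t) < a" if "t \<in> T" "l t \<in> set ps" for t
      using e1(1)[OF that] us(2) that by (auto simp: E1)
    show "e t \<in> T \<and> c (e t) = c t \<and> l (e t) \<in> pivots T c l \<and> a' < l (e t)" if "t \<in> T" "l t \<in> set qs" for t
      using e2(1)[OF that] vs(2) that by (auto simp: E2)
    show "e t = t" if "l t \<notin> set ps" "l t \<notin> set qs" for t using that by (simp add: e_def)
  qed (simp_all add: E1 E2 e1(2) e2(2))
qed

text \<open>Once the context is moved to pivots, the tuple lives on \<open>a\<close>,
  \<open>b\<close> and pivots. There the positions before the swap order it like \<open>l\<close>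
  and those after the swap like \<open>d\<close>, so \<open>pair\<close> says exactly that the swap
  is harmless.\<close>

lemma swap_adjacent_levels:
  assumes T: "finite T" and xs: "set xs \<subseteq> T" and lev: "l ` set xs \<subseteq> set (ps @ a # b # qs)"
    and dist: "distinct (ps @ a # b # qs)" and A: "set (ps @ a # b # qs) \<subseteq> l ` T"
    and len: "length (ps @ a # b # qs) \<le> m" "length xs \<le> m"
    and ab: "a < b" "d b < d a"
    and sorted: "sorted_wrt (may_precede (pivots T c l)) (ps @ a # b # qs)"
    and U: "\<And>u n. u \<in> pivots T c l \<Longrightarrow> n \<in> l ` T \<Longrightarrow> (n < u \<longleftrightarrow> d n < (d u::nat)) \<and> (u < n \<longleftrightarrow> d u < d n)"
    and pair: "\<And>ys. set ys \<subseteq> T \<Longrightarrow> length ys = length xs \<Longrightarrow> l ` set ys \<subseteq> {a, b} \<union> pivots T c l \<Longrightarrow>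
       holds q c l ys = holds q c (\<lambda>x. d (l x)) ys"
  shows "holds q c (\<lambda>x. pos (ps @ a # b # qs) (l x)) xs = holds q c (\<lambda>x. pos (ps @ b # a # qs) (l x)) xs"
proof -
  obtain e where e: 
    "\<And>t. t \<in> T \<Longrightarrow> l t \<in> set ps \<Longrightarrow> e t \<in> T \<and> c (e t) = c t \<and> l (e t) \<in> pivots T c l \<and> l (e t) < a"
    "\<And>t. t \<in> T \<Longrightarrow> l t \<in> set qs \<Longrightarrow> e t \<in> T \<and> c (e t) = c t \<and> l (e t) \<in> pivots T c l \<and> b < l (e t)"
    "\<And>t. l t \<notin> set ps \<Longrightarrow> l t \<notin> set qs \<Longrightarrow> e t = t"
    "\<And>s t. s \<in> T \<Longrightarrow> t \<in> T \<Longrightarrow> l s \<in> set ps \<Longrightarrow> l t \<in> set ps \<Longrightarrow>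
      l (e s) < l (e t) \<longleftrightarrow> pos ps (l s) < pos ps (l t)"
    "\<And>s t. s \<in> T \<Longrightarrow> t \<in> T \<Longrightarrow> l s \<in> set qs \<Longrightarrow> l t \<in> set qs \<Longrightarrow>
      l (e s) < l (e t) \<longleftrightarrow> pos qs (l s) < pos qs (l t)"
    by (rule replace_context[OF T, of c l ps a b qs])
      (use sorted dist A len in \<open>auto simp: sorted_wrt_append\<close>)
  have cases: "l x \<in> set ps \<or> l x = a \<or> l x = b \<or> l x \<in> set qs" if "x \<in> set xs" for x
    using lev that by auto
  have ea: "e x = x" if "l x = a \<or> l x = b" for x using that dist e(3) by auto
  have ce: "c (e x) = c x" "e x \<in> T" if "x \<in> set xs" for x
    using cases[OF that] e(1,2)[of x] ea[of x] xs that by auto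
  have lU: "l (e x) \<in> {a, b} \<union> pivots T c l" if "x \<in> set xs" for x
    using cases[OF that] e(1,2)[of x] ea[of x] xs that by auto
  have AU: "a \<in> l ` T" "b \<in> l ` T" using A by auto
  have ordl: "pos (ps @ a # b # qs) (l x) < pos (ps @ a # b # qs) (l y) \<longleftrightarrow> l (e x) < l (e y)"
    if "x \<in> set xs" "y \<in> set xs" for x y
    by (rule pos_less_four_parts[where X = T, where gu = a and gv = b])
      (use that e ea lev xs dist ab in auto)
  \<comment> \<open>The image is a pivot below \<open>a\<close>, hence below \<open>b\<close>, and
    \<open>d\<close> respects comparisons with pivots; \<open>hi\<close> is symmetric.\<close>
  have lo: "d (l (e x)) < d b" if "x \<in> T" "l x \<in> set ps" for x
  proof -
    have "l (e x) < b" using e(1)[OF that] ab by simp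
    then show ?thesis using e(1)[OF that] U AU by blast
  qed
  have hi: "d a < d (l (e x))" if "x \<in> T" "l x \<in> set qs" for x
  proof -
    have "a < l (e x)" using e(2)[OF that] ab by simp
    then show ?thesis using e(2)[OF that] U AU by blast
  qed
  have mono: "d (l (e x)) < d (l (e y)) \<longleftrightarrow> l (e x) < l (e y)"
    if "l (e x) \<in> pivots T c l" "e y \<in> T" for x y
    using U[OF that(1), of "l (e y)"] that(2) by auto
  have ordd: "pos (ps @ b # a # qs) (l x) < pos (ps @ b # a # qs) (l y) \<longleftrightarrow> d (l (e x)) < d (l (e y))"
    if "x \<in> set xs" "y \<in> set xs" for x y
  proof (rule pos_less_four_parts[where X = T, where gu = "d b" and gv = "d a"])
    show "d (l (e x)) < d (l (e y)) \<longleftrightarrow> pos ps (l x) < pos ps (l y)"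
      if "x \<in> T" "y \<in> T" "l x \<in> set ps" "l y \<in> set ps" for x y
      using mono[of x y] e(1)[of x] e(1)[of y] e(4)[of x y] that by simp
    show "d (l (e x)) < d (l (e y)) \<longleftrightarrow> pos qs (l x) < pos qs (l y)"
      if "x \<in> T" "y \<in> T" "l x \<in> set qs" "l y \<in> set qs" for x y
      using mono[of x y] e(2)[of x] e(2)[of y] e(5)[of x y] that by simp
  qed (use that ea lev xs dist ab lo hi in auto)
  have "holds q c (\<lambda>x. pos (ps @ a # b # qs) (l x)) xs = holds q c l (map e xs)"
    unfolding holds_map by (rule holds_cong) (use ordl ce in auto)
  also have "\<dots> = holds q c (\<lambda>x. d (l x)) (map e xs)"
    by (rule pair) (use ce lU in auto)
  also have "\<dots> = holds q c (\<lambda>x. pos (ps @ b # a # qs) (l x)) xs"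
    unfolding holds_map by (rule holds_cong) (use ordd ce in auto)
  finally show ?thesis .
qed

fun inversions :: "(nat \<Rightarrow> nat) \<Rightarrow> nat list \<Rightarrow> nat" where
  "inversions d [] = 0"
| "inversions d (x # xs) = length (filter (\<lambda>y. d y < d x) xs) + inversions d xs"

lemma inversions_swap:
  "d b < d a \<Longrightarrow> inversions d (ps @ a # b # qs) = Suc (inversions d (ps @ b # a # qs))"
  by (induction ps) auto

text \<open>Bubble sort on the levels met by one tuple: each swap exchanges two neighbouring levels while all
  others are moved to pivots, so it is controlled by the hypothesis on two levels plus pivots.\<close>

lemma rearrange_levels:
  assumes T: "finite T" and xs: "set xs \<subseteq> T" "length xs \<le> m"
    and inj: "inj_on d (l ` T)"
    and U: "\<And>u n. u \<in> pivots T c l \<Longrightarrow> n \<in> l ` T \<Longrightarrow> (n < u \<longleftrightarrow> d n < (d u::nat)) \<and> (u < n \<longleftrightarrow> d u < d n)"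
    and pair: "\<And>a b ys. a \<in> l ` T \<Longrightarrow> b \<in> l ` T \<Longrightarrow>
       set ys \<subseteq> T \<Longrightarrow> length ys = length xs \<Longrightarrow> l ` set ys \<subseteq> {a, b} \<union> pivots T c l \<Longrightarrow>
       holds q c l ys = holds q c (\<lambda>x. d (l x)) ys"
  shows "holds q c l xs = holds q c (\<lambda>x. d (l x)) xs"
proof -
  \<comment> \<open>Invariant of the sorting: any two entries stand in their original or in their
    target order. So an inverted neighbouring pair still has its original order, and no level ever
    jumps over a pivot.\<close>
  let ?agree = "\<lambda>x y. x < y \<or> d x < d y"
  have bubble: "holds q c (\<lambda>x. pos ks (l x)) xs = holds q c (\<lambda>x. d (l x)) xs"
    if "set ks = l ` set xs" "distinct ks" "sorted_wrt ?agree ks" for ks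
    using that
  proof (induction "inversions d ks" arbitrary: ks rule: less_induct)
    case less
    have sub: "set ks \<subseteq> l ` T" using less.prems(1) xs(1) by auto
    show ?case
    proof (cases "sorted (map d ks)")
      case True
      have "inj_on d (set ks)" using inj sub by (rule inj_on_subset)
      then have "distinct (map d ks)" using less.prems(2) by (simp add: distinct_map)
      then have "sorted_wrt (<) (map d ks)" using True by (simp add: strict_sorted_iff)
      then have *: "sorted_wrt (\<lambda>x y. d x < d y) ks" by (simp add: sorted_wrt_map)
      show ?thesis
        by (rule holds_cong) (use less.prems(1) pos_less_sorted[OF *] in auto)
    next
      case False
      then obtain i where i: "Suc i < length ks" "d (ks ! Suc i) < d (ks ! i)"
        by (auto simp: sorted_iff_nth_Suc not_le)
      define ps a b qs where "ps = take i ks" and "a = ks ! i" and "b = ks ! Suc i" and "qs = drop (Suc (Suc i)) ks"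
      have ks: "ks = ps @ a # b # qs"
        unfolding ps_def a_def b_def qs_def using i by (simp add: Cons_nth_drop_Suc)
      have dba: "d b < d a" using i by (simp add: a_def b_def)
      have ab: "a < b" using less.prems(3) dba by (auto simp: ks sorted_wrt_append)
      have may: "may_precede (pivots T c l) x y" if "x \<in> l ` T" "y \<in> l ` T" "?agree x y" for x y
        unfolding may_precede_def
      proof (intro ballI notI)
        fix u assume u: "u \<in> pivots T c l" "y \<le> u \<and> u \<le> x"
        then have "d y \<le> d u" "d u \<le> d x" using U[OF u(1) that(1)] U[OF u(1) that(2)] by (auto simp: not_less[symmetric])
        then show False using that(3) u(2) by auto
      qed
      have sorted: "sorted_wrt (may_precede (pivots T c l)) ks"
        by (rule sorted_wrt_mono_rel[OF _ less.prems(3)]) (use sub may in blast)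
      have "a \<in> l ` T" "b \<in> l ` T" using sub ks by auto
      moreover have "length ks \<le> m"
        using less.prems(1,2) xs(2) by (metis card_image_le card_length distinct_card finite_set le_trans)
      ultimately have "holds q c (\<lambda>x. pos (ps @ a # b # qs) (l x)) xs = holds q c (\<lambda>x. pos (ps @ b # a # qs) (l x)) xs"
        using less.prems(1,2) sub sorted ab dba xs unfolding ks
        by (intro swap_adjacent_levels[where d = d, OF T xs(1)] U pair[of a b]) auto
      also have "\<dots> = holds q c (\<lambda>x. d (l x)) xs"
        using less.prems dba unfolding ks
        by (intro less.hyps) (auto simp: inversions_swap sorted_wrt_append ks)
      finally show ?thesis unfolding ks .
    qed
  qed
  define ks where "ks = sorted_list_of_set (l ` set xs)"
  have ks: "set ks = l ` set xs" "sorted_wrt (<) ks" "distinct ks" by (simp_all add: ks_def)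
  have "holds q c l xs = holds q c (\<lambda>x. pos ks (l x)) xs"
    by (rule holds_cong) (use ks(1) pos_less_sorted[where d = id and ks = ks] ks(2) in auto)
  also have "\<dots> = holds q c (\<lambda>x. d (l x)) xs"
    by (rule bubble[OF ks(1,3)]) (rule sorted_wrt_mono_rel[OF _ ks(2)], simp)
  finally show ?thesis .
qed

text \<open>The level \<open>n\<close> is broken up according to \<open>h\<close>; levels above are shifted by \<open>M\<close> to make room.\<close>

lemma split_level:
  assumes T: "finite T" and xs: "set xs \<subseteq> T" "length xs \<le> m"
    and U: "\<And>u t. u \<in> T \<Longrightarrow> t \<in> T \<Longrightarrow> l u \<in> pivots T c l \<Longrightarrow> (l t < l u \<longleftrightarrow> h t < (h u::nat)) \<and> (l u < l t \<longleftrightarrow> h u < h t)"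
    and core: "\<And>ys. set ys \<subseteq> T \<Longrightarrow> length ys = length xs \<Longrightarrow> l ` set ys \<subseteq> {n} \<union> pivots T c l \<Longrightarrow>
       holds q c l ys = holds q c h ys"
    and M: "\<And>t. t \<in> T \<Longrightarrow> h t < M"
  shows "holds q c l xs =
    holds q c (\<lambda>t. if l t < n then l t else if l t = n then n + h t else l t + M) xs"
    (is "_ = holds q c ?l xs")
proof -
  define ps qs where "ps = sorted_list_of_set (l ` set xs \<inter> {..<n})"
    and "qs = sorted_list_of_set (l ` set xs \<inter> {n<..})"
  have ps: "set ps = l ` set xs \<inter> {..<n}" "sorted_wrt (<) ps"
    and qs: "set qs = l ` set xs \<inter> {n<..}" "sorted_wrt (<) qs"
    by (simp_all add: ps_def qs_def)
  have "card (l ` set xs) \<le> m" using xs(2) by (metis card_image_le card_length finite_set le_trans)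
  then have len: "length ps \<le> m" "length qs \<le> m"
    unfolding ps_def qs_def by (auto intro: le_trans[OF card_mono])
  have may: "may_precede (pivots T c l) x y" if "x < y" for x y
    using that by (auto simp: may_precede_def)
  have "sorted_wrt (<) (ps @ [n])" "sorted_wrt (<) (n # qs)"
    using ps qs by (auto simp: sorted_wrt_append)
  then have sorted: "sorted_wrt (may_precede (pivots T c l)) (ps @ [n])"
    "sorted_wrt (may_precede (pivots T c l)) (n # qs)"
    using may sorted_wrt_mono_rel by metis+
  obtain e where e:
    "\<And>t. t \<in> T \<Longrightarrow> l t \<in> set ps \<Longrightarrow> e t \<in> T \<and> c (e t) = c t \<and> l (e t) \<in> pivots T c l \<and> l (e t) < n"
    "\<And>t. t \<in> T \<Longrightarrow> l t \<in> set qs \<Longrightarrow> e t \<in> T \<and> c (e t) = c t \<and> l (e t) \<in> pivots T c l \<and> n < l (e t)"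
    "\<And>t. l t \<notin> set ps \<Longrightarrow> l t \<notin> set qs \<Longrightarrow> e t = t"
    "\<And>s t. s \<in> T \<Longrightarrow> t \<in> T \<Longrightarrow> l s \<in> set ps \<Longrightarrow> l t \<in> set ps \<Longrightarrow>
      l (e s) < l (e t) \<longleftrightarrow> pos ps (l s) < pos ps (l t)"
    "\<And>s t. s \<in> T \<Longrightarrow> t \<in> T \<Longrightarrow> l s \<in> set qs \<Longrightarrow> l t \<in> set qs \<Longrightarrow>
      l (e s) < l (e t) \<longleftrightarrow> pos qs (l s) < pos qs (l t)"
    by (rule replace_context[OF T sorted(1) _ len(1) sorted(2) _ len(2)])
      (use xs ps qs in auto)
  have lo: "e x \<in> T \<and> c (e x) = c x \<and> l (e x) \<in> pivots T c l \<and> l (e x) < n" if "x \<in> set xs" "l x < n" for x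
    using e(1)[of x] that xs ps by auto
  have hi: "e x \<in> T \<and> c (e x) = c x \<and> l (e x) \<in> pivots T c l \<and> n < l (e x)" if "x \<in> set xs" "n < l x" for x
    using e(2)[of x] that xs qs by auto
  have mid: "e x = x" if "l x = n" for x using that e(3) ps qs by auto
  have lolo: "l (e x) < l (e y) \<longleftrightarrow> l x < l y" if "x \<in> set xs" "y \<in> set xs" "l x < n" "l y < n" for x y
    using e(4)[of x y] that xs ps pos_less_sorted[where d = id and ks = ps] by auto
  have hihi: "l (e x) < l (e y) \<longleftrightarrow> l x < l y" if "x \<in> set xs" "y \<in> set xs" "n < l x" "n < l y" for x y
    using e(5)[of x y] that xs qs pos_less_sorted[where d = id and ks = qs] by auto
  have eT: "e x \<in> T" "c (e x) = c x" "l (e x) \<in> {n} \<union> pivots T c l" if "x \<in> set xs" for x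
    using lo[OF that] hi[OF that] mid[of x] that xs by (cases "l x" n rule: linorder_cases; auto)+
  have ordl: "l x < l y \<longleftrightarrow> l (e x) < l (e y)" if "x \<in> set xs" "y \<in> set xs" for x y
    using lolo[OF that] hihi[OF that] lo[OF that(1)] lo[OF that(2)] hi[OF that(1)] hi[OF that(2)] mid[of x] mid[of y]
    by (cases "l x" n rule: linorder_cases; cases "l y" n rule: linorder_cases) auto
  \<comment> \<open>Unless both elements are on level \<open>n\<close>, one of the images is on a
    pivot level, where \<open>h\<close> and \<open>l\<close> are known to agree.\<close>
  have hpiv: "h (e x) < h (e y) \<longleftrightarrow> l (e x) < l (e y)"
    if "x \<in> set xs" "y \<in> set xs" "l x \<noteq> n \<or> l y \<noteq> n" for x y
  proof -
    have "l (e x) \<in> pivots T c l \<or> l (e y) \<in> pivots T c l"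
      using that lo hi by (metis linorder_neqE_nat)
    then show ?thesis using U[of "e x" "e y"] U[of "e y" "e x"] eT(1) that by auto
  qed
  have ordh: "h (e x) < h (e y) \<longleftrightarrow> ?l x < ?l y" if "x \<in> set xs" "y \<in> set xs" for x y
  proof (cases "l x = n \<and> l y = n")
    case True
    then show ?thesis by (simp add: mid)
  next
    case False
    then have "h (e x) < h (e y) \<longleftrightarrow> l x < l y" using hpiv ordl that by simp
    moreover have "h x < M" "h y < M" using M xs that by auto
    ultimately show ?thesis using False by auto
  qed
  have "holds q c l xs = holds q c l (map e xs)"
    unfolding holds_map by (rule holds_cong) (use ordl eT in auto)
  also have "\<dots> = holds q c h (map e xs)"
    by (rule core) (use eT in auto)
  also have "\<dots> = holds q c ?l xs"
    unfolding holds_map by (rule holds_cong) (use ordh eT in auto)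
  finally show ?thesis .
qed

end

section \<open>Representations with a maximal number of levels\<close>

locale represented_class = order_pattern m Phi for m and Phi :: "'i \<Rightarrow> (nat \<times> nat) list \<Rightarrow> bool" +
  fixes \<sigma> :: "'i signature" and k :: nat
  assumes finite_symbols: "finite (symbols \<sigma>)"
    and arity_le: "q \<in> symbols \<sigma> \<Longrightarrow> arity \<sigma> q \<le> m"
begin

text \<open>The bound on \<open>c\<close> ranges over all elements, so labels at omitted points also
  stay in a finite set. Injectivity says that a letter is used at most once per level.\<close>

definition represents ::
  "('i, 'b) rel_structure \<Rightarrow> 'b set \<Rightarrow> ('b \<Rightarrow> nat) \<Rightarrow> ('b \<Rightarrow> nat) \<Rightarrow> bool" where
  "represents S T c l \<longleftrightarrow> (\<forall>t. c t < k) \<and> inj_on (\<lambda>t. (c t, l t)) T \<and>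
     (\<forall>q\<in>symbols \<sigma>. \<forall>xs\<in>tuples (arity \<sigma> q) T. xs \<in> rels S q \<longleftrightarrow> holds q c l xs)"

definition max_represents ::
  "('i, 'b) rel_structure \<Rightarrow> 'b set \<Rightarrow> ('b \<Rightarrow> nat) \<Rightarrow> ('b \<Rightarrow> nat) \<Rightarrow> bool" where
  "max_represents S T c l \<longleftrightarrow> represents S T c l \<and>
     (\<forall>c' l'. represents S T c' l' \<longrightarrow> card (l' ` T) \<le> card (l ` T))"

lemma representsD:
  assumes "represents S T c l" "q \<in> symbols \<sigma>" "set xs \<subseteq> T" "length xs = arity \<sigma> q"
  shows "xs \<in> rels S q \<longleftrightarrow> holds q c l xs"
  using assms by (auto simp: represents_def tuples_def)

lemma ex_max_represents:
  assumes "represents S T c l" "finite T"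
  shows "\<exists>c l. max_represents S T c l"
proof -
  have "\<exists>p. represents S T (fst p) (snd p) \<and>
      (\<forall>p'. represents S T (fst p') (snd p') \<longrightarrow> card (snd p' ` T) \<le> card (snd p ` T))"
    by (rule ex_has_greatest_nat[where k = "(c, l)" and b = "Suc (card T)"])
      (use assms in \<open>auto simp: card_image_le less_Suc_eq_le\<close>)
  then show ?thesis unfolding max_represents_def by (metis fst_conv snd_conv)
qed

text \<open>This is why levels are maximised: membership in a common level then becomes visible in the
  relations themselves, over the pivots.\<close>

lemma max_represents_unsplittable:
  assumes max: "max_represents S T c l" and T: "finite T"
    and U: "\<And>u t. u \<in> T \<Longrightarrow> t \<in> T \<Longrightarrow> l u \<in> pivots T c l \<Longrightarrow> (l t < l u \<longleftrightarrow> h t < (h u::nat)) \<and> (l u < l t \<longleftrightarrow> h u < h t)"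
    and core: "\<And>q ys. q \<in> symbols \<sigma> \<Longrightarrow> set ys \<subseteq> T \<Longrightarrow> length ys = arity \<sigma> q \<Longrightarrow>
       l ` set ys \<subseteq> {n} \<union> pivots T c l \<Longrightarrow> holds q c l ys = holds q c h ys"
    and st: "s \<in> T" "t \<in> T" "l s = n" "l t = n"
  shows "h s = h t"
proof (rule ccontr)
  assume neq: "h s \<noteq> h t"
  obtain M where M: "\<And>t. t \<in> T \<Longrightarrow> h t < M"
    using T finite_nat_iff_bounded[of "h ` T"] by auto
  define l' where "l' t = (if l t < n then l t else if l t = n then n + h t else l t + M)" for t
  have rep: "represents S T c l" using max by (simp add: max_represents_def)
  \<comment> \<open>\<open>collapse\<close> undoes the refinement. It maps the levels of
    \<open>l'\<close> onto those of \<open>l\<close>, which by maximality are no fewer, so it cannot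
    merge any two.\<close>
  define collapse where "collapse x = (if x < n then x else if x < n + M then n else x - M)" for x
  have coll: "collapse (l' t) = l t" if "t \<in> T" for t
    using M[OF that] by (auto simp: collapse_def l'_def)
  have "represents S T c l'"
    unfolding represents_def
  proof (intro conjI ballI)
    show "\<forall>t. c t < k" using rep by (simp add: represents_def)
    show "inj_on (\<lambda>t. (c t, l' t)) T"
      using rep coll unfolding represents_def inj_on_def by (metis Pair_inject)
    fix q xs assume q: "q \<in> symbols \<sigma>" and "xs \<in> tuples (arity \<sigma> q) T"
    then have xs: "set xs \<subseteq> T" "length xs = arity \<sigma> q" by (auto simp: tuples_def)
    have "holds q c l xs = holds q c l' xs"
      unfolding l'_def
      by (rule split_level[OF T xs(1) _ U core M]) (use q xs arity_le in auto)
    then show "xs \<in> rels S q \<longleftrightarrow> holds q c l' xs" using representsD[OF rep q xs] by simp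
  qed
  then have le: "card (l' ` T) \<le> card (l ` T)" using max by (simp add: max_represents_def)
  have eq: "collapse ` (l' ` T) = l ` T" using coll by (force simp: image_iff)
  have "card (collapse ` (l' ` T)) = card (l' ` T)"
    using le card_image_le[of "l' ` T" collapse] T eq by simp
  then have "inj_on collapse (l' ` T)" using T by (intro eq_card_imp_inj_on) auto
  moreover have "collapse (l' s) = collapse (l' t)" using coll st by simp
  ultimately have "l' s = l' t" using st by (auto dest: inj_onD)
  then show False using neq st by (simp add: l'_def)
qed

text \<open>A code \<open>Inl j\<close> names the \<open>j\<close>-th frame element, a code \<open>Inr a\<close> the element with letter \<open>a\<close> on
  the level of \<open>s\<close>.\<close>

definition decodes ::
  "'b set \<Rightarrow> 'b list \<Rightarrow> ('b \<Rightarrow> nat) \<Rightarrow> ('b \<Rightarrow> nat) \<Rightarrow> 'b \<Rightarrow> nat + nat \<Rightarrow> 'b \<Rightarrow> bool" where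
  "decodes T ks c l s code x \<longleftrightarrow> (case code of Inl j \<Rightarrow> j < length ks \<and> x = ks ! j
     | Inr a \<Rightarrow> x \<in> T \<and> c x = a \<and> l x = l s)"

lemma decodes_unique:
  assumes "inj_on (\<lambda>t. (c t, l t)) T" "list_all2 (decodes T ks c l s) js xs" "list_all2 (decodes T ks c l s) js ys"
  shows "xs = ys"
proof (rule nth_equalityI)
  show "length xs = length ys" using assms(2,3) by (metis list_all2_lengthD)
  fix i assume "i < length xs"
  then have "decodes T ks c l s (js ! i) (xs ! i)" "decodes T ks c l s (js ! i) (ys ! i)"
    using assms(2,3) by (metis list_all2_lengthD list_all2_nthD)+
  then show "xs ! i = ys ! i"
    using assms(1) by (auto simp: decodes_def inj_on_def split: sum.splits)
qed

text \<open>A table of the relations on the frame together with the level of \<open>s\<close>.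
  Elements enter only through codes, which makes tables of different structures comparable.\<close>

definition block_type ::
  "('i, 'b) rel_structure \<Rightarrow> 'b set \<Rightarrow> 'b list \<Rightarrow> ('b \<Rightarrow> nat) \<Rightarrow> ('b \<Rightarrow> nat) \<Rightarrow> 'b \<Rightarrow> ('i \<times> (nat + nat) list) set" where
  "block_type S T ks c l s =
     {(q, js). q \<in> symbols \<sigma> \<and> (\<exists>xs\<in>rels S q. list_all2 (decodes T ks c l s) js xs)}"

text \<open>Two index sets record the order relative to the frame, so that equality of levels shows
  as absence from both. The block is what later prevents distinct levels from merging.\<close>

definition local_label ::
  "('i, 'b) rel_structure \<Rightarrow> 'b set \<Rightarrow> 'b list \<Rightarrow> ('b \<Rightarrow> nat) \<Rightarrow> ('b \<Rightarrow> nat) \<Rightarrow> 'b \<Rightarrow>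
    nat \<times> nat set \<times> nat set \<times> nat set \<times> ('i \<times> (nat + nat) list) set" where
  "local_label S T ks c l s = (c s, block T c l (l s), {j. j < length ks \<and> l (ks ! j) < l s},
     {j. j < length ks \<and> l s < l (ks ! j)}, block_type S T ks c l s)"

text \<open>Tuples avoiding \<open>y\<close> are given by \<open>away\<close>. They suffice to show
  that \<open>f\<close> acts on whole levels, after which sorting reduces any tuple to two levels
  and pivots; only there do tuples through \<open>y\<close> have to be inspected.\<close>

lemma local_label_preserved:
  assumes T: "finite T" and rep: "max_represents S T c l" "represents S' T' c' l'"
    and piv: "\<And>t. t \<in> T \<Longrightarrow> l t \<in> pivots T c l \<Longrightarrow> t \<in> set ks"
    and y: "y \<in> T" "l y \<notin> pivots T c l" "\<And>t. t \<in> T \<Longrightarrow> l t = l y \<Longrightarrow> t \<in> set ks"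
    and fT: "f ` T \<subseteq> T'" and inj: "inj_on f T"
    and ks: "\<And>j. j < length ks \<Longrightarrow> j < length ks' \<and> f (ks ! j) = ks' ! j"
    and lab: "\<And>t. t \<in> T \<Longrightarrow> local_label S T ks c l t = local_label S' T' ks' c' l' (f t)"
    and away: "\<And>q ys. q \<in> symbols \<sigma> \<Longrightarrow> set ys \<subseteq> T - {y} \<Longrightarrow> length ys = arity \<sigma> q \<Longrightarrow>
      ys \<in> rels S q \<longleftrightarrow> map f ys \<in> rels S' q"
    and q: "q \<in> symbols \<sigma>" and xs: "set xs \<subseteq> T" "length xs = arity \<sigma> q"
  shows "xs \<in> rels S q \<longleftrightarrow> map f xs \<in> rels S' q"
proof -
  define h where "h t = l' (f t)" for t
  have rep1: "represents S T c l" using rep(1) by (simp add: max_represents_def)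
  have inj1: "inj_on (\<lambda>t. (c t, l t)) T" and inj2: "inj_on (\<lambda>t. (c' t, l' t)) T'"
    using rep1 rep(2) by (auto simp: represents_def)
  have c: "c' (f t) = c t" if "t \<in> T" for t using lab[OF that] by (simp add: local_label_def)
  have block: "block T' c' l' (h t) = block T c l (l t)" if "t \<in> T" for t
    using lab[OF that] by (simp add: local_label_def h_def)
  have order: "(l t < l u \<longleftrightarrow> h t < h u) \<and> (l u < l t \<longleftrightarrow> h u < h t)" if u: "u \<in> set ks" and t: "t \<in> T" for u t
  proof -
    from u obtain j where j: "j < length ks" "u = ks ! j" by (auto simp: in_set_conv_nth)
    have "{j. j < length ks \<and> l (ks ! j) < l t} = {j. j < length ks' \<and> l' (ks' ! j) < l' (f t)}"
      "{j. j < length ks \<and> l t < l (ks ! j)} = {j. j < length ks' \<and> l' (f t) < l' (ks' ! j)}"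
      using lab[OF t] by (simp_all add: local_label_def)
    then show ?thesis using j ks[OF j(1)] unfolding h_def set_eq_iff mem_Collect_eq by metis
  qed
  have relS': "map f ys \<in> rels S' q \<longleftrightarrow> holds q c h ys"
    if "q \<in> symbols \<sigma>" "set ys \<subseteq> T" "length ys = arity \<sigma> q" for q ys
  proof -
    have "map f ys \<in> rels S' q \<longleftrightarrow> holds q c' l' (map f ys)"
      by (rule representsD[OF rep(2) that(1)]) (use that fT in auto)
    also have "\<dots> \<longleftrightarrow> holds q c h ys"
      unfolding holds_map by (rule holds_cong) (use c that h_def in auto)
    finally show ?thesis .
  qed
  have relS: "ys \<in> rels S q \<longleftrightarrow> holds q c l ys"
    if "q \<in> symbols \<sigma>" "set ys \<subseteq> T" "length ys = arity \<sigma> q" for q ys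
    using representsD[OF rep1] that by blast
  \<comment> \<open>On the level of \<open>y\<close> all elements are in the frame, which decides
    the order. Tuples over any other level and the pivots avoid \<open>y\<close>, so
    \<open>away\<close> applies and maximality forbids splitting that level.\<close>
  have tie: "h s = h t" if "s \<in> T" "t \<in> T" "l s = l t" for s t
  proof (cases "l t = l y")
    case True
    then show ?thesis using order[of s t] order[of t s] y(3) that by fastforce
  next
    case False
    show ?thesis
    proof (rule max_represents_unsplittable[OF rep(1) T _ _ that(1,2) that(3) refl])
      show "(l t < l u \<longleftrightarrow> h t < h u) \<and> (l u < l t \<longleftrightarrow> h u < h t)"
        if "u \<in> T" "t \<in> T" "l u \<in> pivots T c l" for u t
        using order[of u t] piv[of u] that by blast
      fix q ys assume ys: "q \<in> symbols \<sigma>" "set ys \<subseteq> T" "length ys = arity \<sigma> q"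
        "l ` set ys \<subseteq> {l t} \<union> pivots T c l"
      then have "y \<notin> set ys" using False y(2) by auto
      then show "holds q c l ys = holds q c h ys"
        using away[of q ys] relS[of q ys] relS'[of q ys] ys by blast
    qed
  qed
  \<comment> \<open>Equality of blocks puts an element with the letter of \<open>s\<close> on the
    level of \<open>t\<close>; by \<open>tie\<close> it has the same image as \<open>s\<close>, and
    injectivity of \<open>f\<close> identifies the two.\<close>
  have untie: "l s = l t" if st: "s \<in> T" "t \<in> T" "h s = h t" for s t
  proof -
    have "f s \<in> T'" "l' (f s) = h s" "c' (f s) = c s" using st fT c by (auto simp: h_def)
    then have "c s \<in> block T' c' l' (h t)" using st by (auto simp: block_def intro!: rev_image_eqI[of "f s"])
    then obtain x where x: "x \<in> T" "l x = l t" "c x = c s" using block[OF st(2)] by (auto simp: block_def)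
    have "h x = h s" using tie[OF x(1) st(2) x(2)] st(3) by simp
    then have "f x = f s" using c x st fT by (intro inj_onD[OF inj2]) (auto simp: h_def)
    then show ?thesis using inj x st by (auto dest: inj_onD)
  qed
  \<comment> \<open>By \<open>tie\<close>, \<open>h\<close> factors through the levels of
    \<open>l\<close>, and \<open>d\<close> is the factor.\<close>
  define d where "d n = h (SOME t. t \<in> T \<and> l t = n)" for n
  have d: "d (l t) = h t" if "t \<in> T" for t
  proof -
    have "(SOME x. x \<in> T \<and> l x = l t) \<in> T \<and> l (SOME x. x \<in> T \<and> l x = l t) = l t"
      by (rule someI[of _ t]) (use that in simp)
    then show ?thesis unfolding d_def by (intro tie) (use that in auto)
  qed
  have hd: "holds q c (\<lambda>x. d (l x)) ys = holds q c h ys" if "set ys \<subseteq> T" for q ys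
    by (rule holds_cong) (use that in \<open>auto simp: d subset_iff\<close>)
  have "holds q c l xs = holds q c (\<lambda>x. d (l x)) xs"
  proof (rule rearrange_levels[OF T xs(1)])
    show "length xs \<le> m" using arity_le q xs by simp
    show "inj_on d (l ` T)" by (intro inj_onI) (use d in \<open>auto intro: untie\<close>)
    show "(n < u \<longleftrightarrow> d n < d u) \<and> (u < n \<longleftrightarrow> d u < d n)" if u: "u \<in> pivots T c l" and n: "n \<in> l ` T" for u n
    proof -
      obtain x where x: "x \<in> T" "u = l x" using u pivots_subset[of T c l] by blast
      obtain z where z: "z \<in> T" "n = l z" using n by blast
      show ?thesis using order[of x z] piv[of x] x z u d[of x] d[of z] by simp
    qed
    fix a b ys
    assume ab: "a \<in> l ` T" "b \<in> l ` T" and ys: "set ys \<subseteq> T" "length ys = length xs"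
      and lev: "l ` set ys \<subseteq> {a, b} \<union> pivots T c l"
    have ys': "length ys = arity \<sigma> q" using ys xs by simp
    have "ys \<in> rels S q \<longleftrightarrow> map f ys \<in> rels S' q"
    proof (cases "y \<in> set ys")
      case False
      then show ?thesis using away[OF q _ ys'] ys by blast
    next
      case True
      \<comment> \<open>One of the two levels is that of \<open>y\<close> and so belongs to the
        frame. Only one unknown level \<open>n\<close> remains, and the table at an element of
        \<open>n\<close> decides the tuple.\<close>
      then have "l y = a \<or> l y = b" using lev y(2) by auto
      then have "\<exists>n\<in>l ` T. l ` set ys \<subseteq> {n, l y} \<union> pivots T c l"
      proof
        assume "l y = a"
        then show ?thesis by (intro bexI[OF _ ab(2)]) (use lev in blast)
      next
        assume "l y = b"
        then show ?thesis by (intro bexI[OF _ ab(1)]) (use lev in blast)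
      qed
      then obtain n where n: "n \<in> l ` T" "l ` set ys \<subseteq> {n, l y} \<union> pivots T c l" by blast
      obtain s where s: "s \<in> T" "l s = n" using n(1) by blast
      have known: "x \<in> set ks \<or> l x = l s" if x: "x \<in> set ys" for x
      proof -
        have "x \<in> T" "l x \<in> {n, l y} \<union> pivots T c l" using n(2) x ys(1) by auto
        then show ?thesis using s(2) piv[of x] y(3)[of x] by auto
      qed
      have "\<exists>code. decodes T ks c l s code x \<and> decodes T' ks' c' l' (f s) code (f x)" if "x \<in> set ys" for x
      proof (cases "x \<in> set ks")
        case True
        then obtain j where "j < length ks" "x = ks ! j" by (metis in_set_conv_nth)
        then show ?thesis using ks[of j] by (intro exI[of _ "Inl j"]) (simp add: decodes_def)
      next
        case False
        then have "x \<in> T" "l x = l s" using known that ys(1) by auto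
        then show ?thesis using tie[of x s] s(1) fT c
          by (intro exI[of _ "Inr (c x)"]) (auto simp: decodes_def h_def)
      qed
      then obtain code where code: "\<And>x. x \<in> set ys \<Longrightarrow> decodes T ks c l s (code x) x \<and> decodes T' ks' c' l' (f s) (code x) (f x)"
        by metis
      define js where "js = map code ys"
      have js: "list_all2 (decodes T ks c l s) js ys" "list_all2 (decodes T' ks' c' l' (f s)) js (map f ys)"
        using code by (auto simp: js_def list_all2_map1 list_all2_map2 list_all2_same)
      have "ys \<in> rels S q \<longleftrightarrow> (q, js) \<in> block_type S T ks c l s"
      proof -
        have "ys \<in> rels S q \<longleftrightarrow> (\<exists>zs\<in>rels S q. list_all2 (decodes T ks c l s) js zs)"
          using js(1) decodes_unique[OF inj1 js(1)] by blast
        then show ?thesis using q by (simp add: block_type_def)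
      qed
      moreover have "map f ys \<in> rels S' q \<longleftrightarrow> (q, js) \<in> block_type S' T' ks' c' l' (f s)"
      proof -
        have "map f ys \<in> rels S' q \<longleftrightarrow> (\<exists>zs\<in>rels S' q. list_all2 (decodes T' ks' c' l' (f s)) js zs)"
          using js(2) decodes_unique[OF inj2 js(2)] by blast
        then show ?thesis using q by (simp add: block_type_def)
      qed
      ultimately show ?thesis using lab[OF s(1)] by (simp add: local_label_def)
    qed
    then show "holds q c l ys = holds q c (\<lambda>x. d (l x)) ys"
      using relS[OF q ys(1) ys'] relS'[OF q ys(1) ys'] hd[OF ys(1)] by simp
  qed
  then show ?thesis using relS[OF q xs] relS'[OF q xs] hd[OF xs(1)] by simp
qed

end

section \<open>Labelled words and embeddings\<close>

definition embedding ::
  "'i signature \<Rightarrow> ('b \<Rightarrow> 'c) \<Rightarrow> ('i, 'b) rel_structure \<Rightarrow> ('i, 'c) rel_structure \<Rightarrow> bool" where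
  "embedding \<sigma> f S T \<longleftrightarrow> inj_on f (base_set S) \<and> f ` base_set S \<subseteq> base_set T \<and>
     (\<forall>q\<in>symbols \<sigma>. \<forall>xs\<in>tuples (arity \<sigma> q) (base_set S). xs \<in> rels S q \<longleftrightarrow> map f xs \<in> rels T q)"

lemma embeds_iff_embedding: "embeds \<sigma> S T \<longleftrightarrow> (\<exists>f. embedding \<sigma> f S T)"
proof
  assume "embeds \<sigma> S T"
  then obtain A f where A: "A \<subseteq> base_set T" "isomorphism \<sigma> f S (induced T A)"
    by (auto simp: embeds_def isomorphic_def)
  then have "f ` base_set S = A" by (auto simp: isomorphism_def induced_def bij_betw_def)
  then have "embedding \<sigma> f S T"
    using A by (auto simp: isomorphism_def embedding_def induced_def bij_betw_def tuples_def in_lists_conv_set)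
  then show "\<exists>f. embedding \<sigma> f S T" by blast
next
  assume "\<exists>f. embedding \<sigma> f S T"
  then obtain f where f: "embedding \<sigma> f S T" by blast
  then have "isomorphism \<sigma> f S (induced T (f ` base_set S))"
    by (auto simp: isomorphism_def embedding_def induced_def bij_betw_def tuples_def in_lists_conv_set)
  then show "embeds \<sigma> S T"
    using f unfolding embeds_def isomorphic_def embedding_def by blast
qed

lemma embedding_into_induced:
  assumes "embedding \<sigma> f S T" "f ` base_set S \<subseteq> A"
  shows "embedding \<sigma> f S (induced T A)"
proof -
  have "map f xs \<in> lists A" if "xs \<in> tuples n (base_set S)" for xs n
    using that assms(2) by (auto simp: tuples_def image_subset_iff subset_iff)
  then show ?thesis using assms by (simp add: embedding_def induced_def)
qed

lemma embedding_comp: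
  assumes "embedding \<sigma> f S T" "embedding \<sigma> g T U"
  shows "embedding \<sigma> (g \<circ> f) S U"
  unfolding embedding_def
proof (intro conjI ballI)
  show "inj_on (g \<circ> f) (base_set S)" "(g \<circ> f) ` base_set S \<subseteq> base_set U"
    using assms by (auto simp: embedding_def image_subset_iff intro!: comp_inj_on intro: inj_on_subset)
  fix q xs assume q: "q \<in> symbols \<sigma>" and xs: "xs \<in> tuples (arity \<sigma> q) (base_set S)"
  have "map f xs \<in> tuples (arity \<sigma> q) (base_set T)"
    using xs assms(1) by (auto simp: tuples_def embedding_def)
  then show "xs \<in> rels S q \<longleftrightarrow> map (g \<circ> f) xs \<in> rels U q"
    using assms q xs unfolding embedding_def by (metis map_map)
qed

text \<open>If the image missed a point of \<open>T\<close>, then \<open>S\<close> would embed into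
  \<open>T\<close> without that point, and hence into \<open>R\<close>.\<close>

lemma bounds_antichain:
  assumes S: "is_bound \<sigma> R S" and T: "is_bound \<sigma> R T" and "embedding \<sigma> f S T"
  shows "isomorphism \<sigma> f S T"
proof (cases "f ` base_set S = base_set T")
  case True
  then show ?thesis using assms(3) by (auto simp: isomorphism_def embedding_def bij_betw_def)
next
  case False
  then obtain x where x: "x \<in> base_set T" "x \<notin> f ` base_set S"
    using assms(3) by (auto simp: embedding_def)
  then have "embeds \<sigma> S (induced T (base_set T - {x}))"
    unfolding embeds_iff_embedding using assms(3)
    by (intro exI[of _ f] embedding_into_induced) (auto simp: embedding_def)
  moreover have "embeds \<sigma> (induced T (base_set T - {x})) R"
    using T x by (simp add: is_bound_def)
  ultimately have "embeds \<sigma> S R"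
    unfolding embeds_iff_embedding using embedding_comp by blast
  then show ?thesis using S by (simp add: is_bound_def)
qed

text \<open>Transported to initial segments of the natural numbers, the structures have only
  finitely many relation tables, so two of them coincide.\<close>

lemma isomorphic_if_bounded_size:
  fixes S :: "nat \<Rightarrow> ('i, 'b) rel_structure"
  assumes fin: "finite (symbols \<sigma>)"
    and S: "\<And>n. finite (base_set (S n)) \<and> card (base_set (S n)) \<le> M"
  shows "\<exists>i j. i \<noteq> j \<and> isomorphic \<sigma> (S i) (S j)"
proof -
  have "\<forall>n. \<exists>h. bij_betw h {0..<card (base_set (S n))} (base_set (S n))"
    using S ex_bij_betw_nat_finite by blast
  then obtain h where h: "\<And>n. bij_betw (h n) {0..<card (base_set (S n))} (base_set (S n))" by metis
  define code where "code n = (card (base_set (S n)),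
    {(q, js). q \<in> symbols \<sigma> \<and> js \<in> tuples (arity \<sigma> q) {0..<card (base_set (S n))} \<and> map (h n) js \<in> rels (S n) q})" for n
  let ?Q = "SIGMA q:symbols \<sigma>. {js. set js \<subseteq> {0..<M} \<and> length js = arity \<sigma> q}"
  have "range code \<subseteq> {..M} \<times> Pow ?Q"
  proof -
    have "code n \<in> {..M} \<times> Pow ?Q" for n
      using S[of n] by (fastforce simp: code_def tuples_def)
    then show ?thesis by blast
  qed
  moreover have "finite ({..M} \<times> Pow ?Q)"
    using fin by (intro finite_cartesian_product finite_atMost iffD2[OF finite_Pow_iff]
        finite_SigmaI finite_lists_length_eq) auto
  ultimately have "finite (range code)" by (rule finite_subset)
  then have "\<not> inj code" using finite_imageD infinite_UNIV_nat by blast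
  then obtain i j where ij: "i \<noteq> j" "code i = code j" by (auto simp: inj_def)
  define f where "f = h j \<circ> inv_into {0..<card (base_set (S i))} (h i)"
  have card: "card (base_set (S j)) = card (base_set (S i))"
    and rel: "\<And>q js. q \<in> symbols \<sigma> \<Longrightarrow> js \<in> tuples (arity \<sigma> q) {0..<card (base_set (S i))} \<Longrightarrow>
      map (h i) js \<in> rels (S i) q \<longleftrightarrow> map (h j) js \<in> rels (S j) q"
  proof -
    show card: "card (base_set (S j)) = card (base_set (S i))" using ij(2) by (simp add: code_def)
    fix q js assume "q \<in> symbols \<sigma>" "js \<in> tuples (arity \<sigma> q) {0..<card (base_set (S i))}"
    moreover have "(q, js) \<in> snd (code i) \<longleftrightarrow> (q, js) \<in> snd (code j)" using ij(2) by simp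
    ultimately show "map (h i) js \<in> rels (S i) q \<longleftrightarrow> map (h j) js \<in> rels (S j) q"
      using card by (simp add: code_def)
  qed
  have inv: "bij_betw (inv_into {0..<card (base_set (S i))} (h i)) (base_set (S i)) {0..<card (base_set (S i))}"
    using h by (rule bij_betw_inv_into)
  have "isomorphism \<sigma> f (S i) (S j)"
    unfolding isomorphism_def
  proof (intro conjI ballI)
    show "bij_betw f (base_set (S i)) (base_set (S j))"
      unfolding f_def using inv h[of j] card by (auto intro: bij_betw_trans)
    fix q xs assume q: "q \<in> symbols \<sigma>" and xs: "xs \<in> tuples (arity \<sigma> q) (base_set (S i))"
    define js where "js = map (inv_into {0..<card (base_set (S i))} (h i)) xs"
    have js: "js \<in> tuples (arity \<sigma> q) {0..<card (base_set (S i))}"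
      unfolding js_def using inv xs by (rule map_in_tuples)
    have "map (h i) js = xs"
      unfolding js_def map_map using xs h[of i]
      by (intro map_idI) (auto simp: tuples_def bij_betw_def f_inv_into_f)
    moreover have "map (h j) js = map f xs" by (simp add: js_def f_def)
    ultimately show "xs \<in> rels (S i) q \<longleftrightarrow> map f xs \<in> rels (S j) q" using rel[OF q js] by simp
  qed
  then show ?thesis using ij(1) unfolding isomorphic_def by blast
qed

text \<open>The entries are singletons or empty, since a letter occurs at most once on a level.\<close>

definition letter :: "nat \<Rightarrow> 'b set \<Rightarrow> ('b \<Rightarrow> 'x) \<Rightarrow> ('b \<Rightarrow> nat) \<Rightarrow> ('b \<Rightarrow> nat) \<Rightarrow> nat \<Rightarrow> 'x set list" where
  "letter k T lab c l n = map (\<lambda>a. {lab t | t. t \<in> T \<and> c t = a \<and> l t = n}) [0..<k]"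

definition word :: "nat \<Rightarrow> 'b set \<Rightarrow> ('b \<Rightarrow> 'x) \<Rightarrow> ('b \<Rightarrow> nat) \<Rightarrow> ('b \<Rightarrow> nat) \<Rightarrow> 'x set list list" where
  "word k T lab c l = map (letter k T lab c l) (sorted_list_of_set (l ` T))"

lemma word_alphabet:
  assumes "lab ` T \<subseteq> X"
  shows "set (word k T lab c l) \<subseteq> {w. set w \<subseteq> Pow X \<and> length w = k}"
proof -
  have "set (letter k T lab c l n) \<subseteq> Pow X" "length (letter k T lab c l n) = k" for n
    using assms by (auto simp: letter_def)
  then show ?thesis by (auto simp: word_def)
qed

text \<open>Matched levels carry equal letters, so entry \<open>c t\<close> contains the label of
  \<open>t\<close> on both sides and yields an image. The increasing index map of the subsequence
  preserves the order of levels in both directions.\<close>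

lemma subseq_word_map:
  assumes T: "finite T" "finite T'" and c: "\<And>t. t \<in> T \<Longrightarrow> c t < k"
    and sub: "subseq (word k T lab c l) (word k T' lab' c' l')"
  shows "\<exists>f. (\<forall>t\<in>T. f t \<in> T' \<and> c' (f t) = c t \<and> lab' (f t) = lab t) \<and>
    (\<forall>s\<in>T. \<forall>t\<in>T. l s < l t \<longleftrightarrow> l' (f s) < l' (f t))"
proof -
  define ls ls' where "ls = sorted_list_of_set (l ` T)" and "ls' = sorted_list_of_set (l' ` T')"
  have ls: "set ls = l ` T" "sorted_wrt (<) ls" and ls': "sorted_wrt (<) ls'"
    using T by (simp_all add: ls_def ls'_def)
  obtain p where "\<forall>j<length ls. p j < length ls' \<and> map (letter k T lab c l) ls ! j = map (letter k T' lab' c' l') ls' ! p j"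
    and mono: "\<And>i j. i < j \<Longrightarrow> j < length ls \<Longrightarrow> p i < p j"
    using subseq_index_map[OF sub] unfolding word_def ls_def[symmetric] ls'_def[symmetric] length_map by blast
  then have p: "\<And>j. j < length ls \<Longrightarrow> p j < length ls' \<and> letter k T lab c l (ls ! j) = letter k T' lab' c' l' (ls' ! p j)"
    by (metis nth_map)
  have "\<exists>t'\<in>T'. c' t' = c t \<and> lab' t' = lab t \<and> l' t' = ls' ! p (pos ls (l t))" if t: "t \<in> T" for t
  proof -
    have lt: "l t \<in> set ls" using ls t by simp
    have "letter k T lab c l (l t) = letter k T' lab' c' l' (ls' ! p (pos ls (l t)))"
      using p[OF pos_less_length[OF lt]] nth_pos[OF lt] by simp
    then have "letter k T lab c l (l t) ! c t = letter k T' lab' c' l' (ls' ! p (pos ls (l t))) ! c t" by simp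
    then have "{lab u | u. u \<in> T \<and> c u = c t \<and> l u = l t} =
        {lab' u | u. u \<in> T' \<and> c' u = c t \<and> l' u = ls' ! p (pos ls (l t))}"
      using c[OF t] by (simp add: letter_def)
    moreover have "lab t \<in> {lab u | u. u \<in> T \<and> c u = c t \<and> l u = l t}" using t by blast
    ultimately show ?thesis by auto
  qed
  then obtain f where f: "\<And>t. t \<in> T \<Longrightarrow> f t \<in> T' \<and> c' (f t) = c t \<and> lab' (f t) = lab t \<and> l' (f t) = ls' ! p (pos ls (l t))"
    by metis
  have "l s < l t \<longleftrightarrow> l' (f s) < l' (f t)" if st: "s \<in> T" "t \<in> T" for s t
  proof -
    have up: "l' (f s) < l' (f t)" if "l s < l t" "s \<in> T" "t \<in> T" for s t
    proof -
      have in_ls: "l s \<in> set ls" "l t \<in> set ls" using ls that by auto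
      have "pos ls (l s) < pos ls (l t)"
        using pos_less_sorted[where d = id and ks = ls] ls(2) in_ls that(1) by simp
      then have "p (pos ls (l s)) < p (pos ls (l t))" using mono pos_less_length in_ls by blast
      then show ?thesis using sorted_wrt_nth_less[OF ls'] p pos_less_length in_ls f that by simp
    qed
    have "l' (f s) = l' (f t)" if "l s = l t" using f[OF st(1)] f[OF st(2)] that by simp
    then show ?thesis using up[of s t] up[of t s] st by (cases "l s" "l t" rule: linorder_cases) auto
  qed
  then show ?thesis using f by blast
qed

section \<open>Frames, labels and Higman's lemma for large structures\<close>

context represented_class
begin

text \<open>Twice the number of short words over sets of letters bounds the pivot levels, and each
  level has at most \<open>k\<close> elements.\<close>

definition pivot_bound :: nat where
  "pivot_bound = 2 * card {p. set p \<subseteq> Pow {..<k} \<and> length p \<le> m} * k"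

lemma card_levels:
  assumes "represents S T c l" "finite X"
  shows "finite {t \<in> T. l t \<in> X}" and "card {t \<in> T. l t \<in> X} \<le> card X * k"
proof -
  let ?g = "\<lambda>t. (l t, c t)"
  have inj: "inj_on ?g {t \<in> T. l t \<in> X}"
    using assms(1) by (auto simp: represents_def inj_on_def)
  have sub: "?g ` {t \<in> T. l t \<in> X} \<subseteq> X \<times> {..<k}"
    using assms(1) by (auto simp: represents_def)
  have fin: "finite (X \<times> {..<k})" using assms(2) by simp
  show "finite {t \<in> T. l t \<in> X}" using inj sub fin by (meson finite_imageD finite_subset)
  show "card {t \<in> T. l t \<in> X} \<le> card X * k" using card_inj_on_le[OF inj sub fin] by (simp add: card_cartesian_product)
qed

lemma card_pivot_elements:
  assumes "represents S T c l"
  shows "finite {t \<in> T. l t \<in> pivots T c l}" and "card {t \<in> T. l t \<in> pivots T c l} \<le> pivot_bound"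
proof -
  have "block T c l ` l ` T \<subseteq> Pow {..<k}"
    using assms by (auto simp: block_def represents_def)
  note fin = card_unstable(1)[OF _ this, of m, folded pivots_def]
    and card = card_unstable(2)[OF _ this, of m, folded pivots_def]
  have fin: "finite (pivots T c l)" using fin by simp
  show "finite {t \<in> T. l t \<in> pivots T c l}" using card_levels(1)[OF assms fin] .
  show "card {t \<in> T. l t \<in> pivots T c l} \<le> pivot_bound"
    unfolding pivot_bound_def
    by (rule order_trans[OF card_levels(2)[OF assms fin] mult_right_mono[OF card]]) simp_all
qed

text \<open>The \<open>m + 1\<close> omitted points, then \<open>y\<close>, then for each of the
  \<open>m + 1\<close> representations at most \<open>pivot_bound\<close> elements on pivot levels
  and \<open>k\<close> on the level of \<open>y\<close>.\<close>

definition frame_length :: nat where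
  "frame_length = Suc m + Suc (Suc m * (pivot_bound + k))"

text \<open>The entries \<open>ks ! 0, \<dots>, ks ! m\<close> are the points omitted by the \<open>m + 1\<close> maximal
  representations; \<open>ks ! Suc m\<close> is the point omitted by the representation that serves as the word
  for Higman's lemma. \<open>L i\<close> is meaningless at \<open>ks ! i\<close>.\<close>

definition framed ::
  "('i, 'b) rel_structure \<Rightarrow> 'b list \<Rightarrow> (nat \<Rightarrow> 'b \<Rightarrow> nat) \<Rightarrow> (nat \<Rightarrow> 'b \<Rightarrow> nat) \<Rightarrow>
    ('b \<Rightarrow> nat) \<Rightarrow> ('b \<Rightarrow> nat) \<Rightarrow> bool" where
  "framed S ks C L c l \<longleftrightarrow> finite (base_set S) \<and> is_structure \<sigma> S \<and>
     Suc m < length ks \<and> length ks \<le> frame_length \<and> set ks \<subseteq> base_set S \<and> distinct (take (Suc m) ks) \<and>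
     represents S (base_set S - {ks ! Suc m}) c l \<and>
     (\<forall>i\<le>m. let T = base_set S - {ks ! i} in max_represents S T (C i) (L i) \<and>
        ks ! Suc m \<noteq> ks ! i \<and> L i (ks ! Suc m) \<notin> pivots T (C i) (L i) \<and>
        (\<forall>t\<in>T. L i t \<in> pivots T (C i) (L i) \<or> L i t = L i (ks ! Suc m) \<longrightarrow> t \<in> set ks))"

lemma ex_framed:
  assumes fin: "finite (base_set S)" and str: "is_structure \<sigma> S"
    and large: "Suc m * Suc pivot_bound < card (base_set S)"
    and rep: "\<And>x. x \<in> base_set S \<Longrightarrow> \<exists>c l. represents S (base_set S - {x}) c l"
  shows "\<exists>ks C L c l. framed S ks C L c l"
proof -
  obtain bs where bs: "set bs = base_set S" "distinct bs" using fin finite_distinct_list by blast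
  then have "Suc m < length bs" using large distinct_card[OF bs(2)] by simp
  define ys where "ys = take (Suc m) bs"
  have ys: "length ys = Suc m" "distinct ys" "set ys \<subseteq> base_set S"
    using bs \<open>Suc m < length bs\<close> by (auto simp: ys_def dest: in_set_takeD)
  have "\<exists>c l. max_represents S (base_set S - {ys ! i}) c l" if "i \<le> m" for i
  proof -
    have "ys ! i \<in> base_set S" using ys that by (metis less_Suc_eq_le nth_mem subsetD)
    then show ?thesis using rep[of "ys ! i"] ex_max_represents fin by blast
  qed
  then obtain C L where CL: "\<And>i. i \<le> m \<Longrightarrow> max_represents S (base_set S - {ys ! i}) (C i) (L i)"
    by metis
  then have rp: "represents S (base_set S - {ys ! i}) (C i) (L i)" if "i \<le> m" for i
    using that by (auto simp: max_represents_def)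
  define P where "P i = {t \<in> base_set S - {ys ! i}. L i t \<in> pivots (base_set S - {ys ! i}) (C i) (L i)}" for i
  have P: "finite (P i)" "card (P i) \<le> pivot_bound" if "i \<le> m" for i
    using card_pivot_elements[OF rp[OF that]] by (simp_all add: P_def)
  have "card (set ys \<union> (\<Union>i\<le>m. P i)) \<le> card (set ys) + card (\<Union>i\<le>m. P i)" by (rule card_Un_le)
  also have "card (\<Union>i\<le>m. P i) \<le> (\<Sum>i\<le>m. card (P i))" by (rule card_UN_le) simp
  also have "\<dots> \<le> (\<Sum>i\<le>m. pivot_bound)" by (rule sum_mono) (use P in auto)
  also have "card (set ys) = Suc m" using ys distinct_card by fastforce
  finally have "card (set ys \<union> (\<Union>i\<le>m. P i)) < card (base_set S)" using large by simp
  moreover have "finite (set ys \<union> (\<Union>i\<le>m. P i))" using P by simp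
  \<comment> \<open>The size hypothesis counts the \<open>m + 1\<close> omitted points and at most
    \<open>pivot_bound\<close> pivot elements for each, so some \<open>y\<close> escapes them
    all.\<close>
  ultimately have "\<not> base_set S \<subseteq> set ys \<union> (\<Union>i\<le>m. P i)"
    using card_mono by (metis leD)
  then obtain y where y: "y \<in> base_set S" "y \<notin> set ys" "\<And>i. i \<le> m \<Longrightarrow> y \<notin> P i" by blast
  obtain c l where cl: "represents S (base_set S - {y}) c l" using rep y(1) by blast
  define E where "E i = {t \<in> base_set S - {ys ! i}. L i t \<in> {L i y}}" for i
  have E: "finite (E i)" "card (E i) \<le> k" if "i \<le> m" for i
    using card_levels[OF rp[OF that], of "{L i y}"] by (simp_all add: E_def)
  have "card (\<Union>i\<le>m. P i \<union> E i) \<le> (\<Sum>i\<le>m. card (P i \<union> E i))" by (rule card_UN_le) simp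
  also have "\<dots> \<le> (\<Sum>i\<le>m. pivot_bound + k)"
  proof (rule sum_mono)
    fix i assume "i \<in> {..m}"
    then show "card (P i \<union> E i) \<le> pivot_bound + k"
      using P(2)[of i] E(2)[of i] card_Un_le[of "P i" "E i"] by simp
  qed
  finally have card: "card (\<Union>i\<le>m. P i \<union> E i) \<le> Suc m * (pivot_bound + k)" by simp
  have "finite (\<Union>i\<le>m. P i \<union> E i)" using P E by simp
  from finite_distinct_list[OF this]
  obtain es where es: "set es = (\<Union>i\<le>m. P i \<union> E i)" "distinct es" by blast
  define ks where "ks = ys @ y # es"
  have ksi: "ks ! i = ys ! i" if "i \<le> m" for i using that ys by (simp add: ks_def nth_append)
  have ksm: "ks ! Suc m = y" using ys by (simp add: ks_def nth_append)
  have "framed S ks C L c l"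
    unfolding framed_def Let_def ksm
  proof (intro conjI allI impI)
    show "length ks \<le> frame_length"
      using card distinct_card[OF es(2)] es(1) ys by (simp add: ks_def frame_length_def)
    show "set ks \<subseteq> base_set S" using ys y es by (auto simp: ks_def P_def E_def)
    show "distinct (take (Suc m) ks)" using ys by (simp add: ks_def)
  next
    fix i assume i: "i \<le> m"
    show "max_represents S (base_set S - {ks ! i}) (C i) (L i)" using CL i ksi by simp
    show neq: "y \<noteq> ks ! i" using y(2) ys i ksi by (metis less_Suc_eq_le nth_mem)
    show "L i y \<notin> pivots (base_set S - {ks ! i}) (C i) (L i)"
      using y(1) y(3)[OF i] neq i ksi by (auto simp: P_def)
    show "\<forall>t\<in>base_set S - {ks ! i}. L i t \<in> pivots (base_set S - {ks ! i}) (C i) (L i) \<or> L i t = L i y \<longrightarrow> t \<in> set ks"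
      using es(1) i ksi by (auto simp: ks_def P_def E_def)
  qed (use fin str cl ys in \<open>simp_all add: ks_def\<close>)
  then show ?thesis by blast
qed

text \<open>A set of indices is recorded because entries of \<open>ks\<close> may repeat: in
  \<open>ex_framed\<close>, \<open>y\<close> recurs among the elements of its own levels. Equality
  of these sets forces a label-preserving map to carry frame to frame.\<close>

definition label ::
  "('i, 'b) rel_structure \<Rightarrow> 'b list \<Rightarrow> (nat \<Rightarrow> 'b \<Rightarrow> nat) \<Rightarrow> (nat \<Rightarrow> 'b \<Rightarrow> nat) \<Rightarrow> 'b \<Rightarrow>
    nat set \<times> (nat \<times> nat set \<times> nat set \<times> nat set \<times> ('i \<times> (nat + nat) list) set) list" where
  "label S ks C L s = ({j. j < length ks \<and> ks ! j = s},
     map (\<lambda>i. local_label S (base_set S - {ks ! i}) ks (C i) (L i) s) [0..<Suc m])"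

text \<open>One finite set serves all framed structures, since a label mentions frame elements only
  by index and all other elements only by letter.\<close>

lemma finite_labels:
  "\<exists>X. finite X \<and> (\<forall>(S :: ('i, 'b) rel_structure) ks C L c l s. framed S ks C L c l \<longrightarrow> label S ks C L s \<in> X)"
proof -
  let ?N = frame_length
  let ?J = "Inl ` {..<?N} \<union> Inr ` {..<k}"
  let ?Q = "symbols \<sigma> \<times> {js. set js \<subseteq> ?J \<and> length js \<le> m}"
  let ?Y = "{..<k} \<times> Pow {..<k} \<times> Pow {..<?N} \<times> Pow {..<?N} \<times> Pow ?Q"
  let ?X = "Pow {..<?N} \<times> {ys. set ys \<subseteq> ?Y \<and> length ys = Suc m}"
  have "finite ?Q" using finite_symbols by (intro finite_cartesian_product finite_lists_length_le) auto
  then have Y: "finite ?Y" by (intro finite_cartesian_product) auto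
  have "finite ?X" by (rule finite_cartesian_product[OF _ finite_lists_length_eq[OF Y]]) simp
  moreover have "label S ks C L s \<in> ?X" if fr: "framed S ks C L c l"
    for S :: "('i, 'b) rel_structure" and ks C L c l s
  proof -
    have N: "length ks \<le> ?N" using fr by (simp add: framed_def)
    have "local_label S (base_set S - {ks ! i}) ks (C i) (L i) s \<in> ?Y" if "i \<in> {0..<Suc m}" for i
    proof -
      have C: "C i t < k" for t
        using fr that by (auto simp: framed_def Let_def max_represents_def represents_def)
      have "block_type S (base_set S - {ks ! i}) ks (C i) (L i) s \<subseteq> ?Q"
      proof
        fix qj assume "qj \<in> block_type S (base_set S - {ks ! i}) ks (C i) (L i) s"
        then obtain q js xs where q: "qj = (q, js)" "q \<in> symbols \<sigma>" and xs: "xs \<in> rels S q"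
          and js: "list_all2 (decodes (base_set S - {ks ! i}) ks (C i) (L i) s) js xs"
          by (auto simp: block_type_def)
        have "length xs = arity \<sigma> q"
          using fr q xs by (auto simp: framed_def is_structure_def tuples_def)
        then have "length js \<le> m" using js arity_le[OF q(2)] by (simp add: list_all2_lengthD)
        moreover have "set js \<subseteq> ?J"
        proof
          fix code assume "code \<in> set js"
          then obtain x where "decodes (base_set S - {ks ! i}) ks (C i) (L i) s code x"
            using js by (metis in_set_conv_nth list_all2_conv_all_nth)
          then show "code \<in> ?J" using N C by (auto simp: decodes_def split: sum.splits)
        qed
        ultimately show "qj \<in> ?Q" using q by simp
      qed
      moreover have "block (base_set S - {ks ! i}) (C i) (L i) (L i s) \<subseteq> {..<k}"
        using C by (auto simp: block_def)
      ultimately show ?thesis using C N by (auto simp: local_label_def)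
    qed
    then have "(\<lambda>i. local_label S (base_set S - {ks ! i}) ks (C i) (L i) s) ` {0..<Suc m} \<subseteq> ?Y"
      by (rule image_subsetI)
    moreover have "{j. j < length ks \<and> ks ! j = s} \<in> Pow {..<?N}" using N by auto
    ultimately show ?thesis
      unfolding label_def by (intro SigmaI CollectI conjI) (simp_all only: set_map set_upt length_map length_upt diff_zero)
  qed
  ultimately show ?thesis by blast
qed

text \<open>The compared word settles the tuples that miss \<open>ks ! Suc m\<close>. This seeds the
  hypothesis \<open>away\<close> of \<open>local_label_preserved\<close>, applied to whichever of
  the \<open>m + 1\<close> omitted points the given tuple misses.\<close>

lemma embedding_if_labels_preserved:
  fixes S :: "('i, 'b) rel_structure" and S' :: "('i, 'd) rel_structure"
  assumes S: "framed S ks C L c l" and S': "framed S' ks' C' L' c' l'"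
    and base: "f ` (base_set S - {ks ! Suc m}) \<subseteq> base_set S' - {ks' ! Suc m}"
    and fy: "f (ks ! Suc m) = ks' ! Suc m"
    and lab: "\<And>s. s \<in> base_set S \<Longrightarrow> label S ks C L s = label S' ks' C' L' (f s)"
    and c: "\<And>s. s \<in> base_set S - {ks ! Suc m} \<Longrightarrow> c' (f s) = c s"
    and l: "\<And>s t. s \<in> base_set S - {ks ! Suc m} \<Longrightarrow> t \<in> base_set S - {ks ! Suc m} \<Longrightarrow>
      l s < l t \<longleftrightarrow> l' (f s) < l' (f t)"
  shows "embedding \<sigma> f S S'"
proof -
  define B B' y where "B = base_set S" and "B' = base_set S'" and "y = ks ! Suc m"
  have rep: "represents S (B - {y}) c l" and rep': "represents S' (B' - {ks' ! Suc m}) c' l'"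
    using S S' by (auto simp: framed_def B_def B'_def y_def)
  have ksB: "set ks \<subseteq> B" "Suc m < length ks" "y \<in> B"
    and ksB': "set ks' \<subseteq> B'" "Suc m < length ks'"
    using S S' nth_mem by (auto simp: framed_def B_def B'_def y_def)
  have ks: "j < length ks' \<and> f (ks ! j) = ks' ! j" if "j < length ks" for j
  proof -
    have "ks ! j \<in> base_set S" using ksB that nth_mem by (auto simp: B_def)
    then have "{i. i < length ks \<and> ks ! i = ks ! j} = {i. i < length ks' \<and> ks' ! i = f (ks ! j)}"
      using lab by (simp add: label_def)
    moreover have "j \<in> {i. i < length ks \<and> ks ! i = ks ! j}" using that by simp
    ultimately have "j \<in> {i. i < length ks' \<and> ks' ! i = f (ks ! j)}" by (simp only:)
    then show ?thesis by simp
  qed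
  have "f y \<in> B'" using fy ksB' nth_mem[of "Suc m" ks'] by (auto simp: y_def)
  then have fB: "f ` B \<subseteq> B'" using base by (auto simp: B_def B'_def y_def image_subset_iff)
  have inj0: "inj_on f (B - {y})"
  proof (rule inj_onI)
    fix s t assume st: "s \<in> B - {y}" "t \<in> B - {y}" "f s = f t"
    then have st': "s \<in> base_set S - {ks ! Suc m}" "t \<in> base_set S - {ks ! Suc m}"
      by (simp_all add: B_def y_def)
    have "c s = c t" using c[OF st'(1)] c[OF st'(2)] st(3) by simp
    moreover have "l s = l t" using l[OF st'] l[OF st'(2,1)] st(3) by simp
    moreover have "inj_on (\<lambda>t. (c t, l t)) (B - {y})" using rep by (simp add: represents_def)
    ultimately show "s = t" using st(1,2) by (auto dest: inj_onD)
  qed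
  have inj: "inj_on f B"
  proof -
    have "f y \<notin> f ` (B - {y})" using base fy by (auto simp: B_def y_def)
    then show ?thesis using inj0 inj_on_insert[of f y "B - {y}"] ksB(3) by (simp add: insert_absorb)
  qed
  have away: "ys \<in> rels S q \<longleftrightarrow> map f ys \<in> rels S' q"
    if q: "q \<in> symbols \<sigma>" and ys: "set ys \<subseteq> B - {y}" "length ys = arity \<sigma> q" for q ys
  proof -
    have in_base: "x \<in> base_set S - {ks ! Suc m}" if "x \<in> set ys" for x
      using ys(1) that by (auto simp: B_def y_def)
    have "holds q c l ys = holds q (\<lambda>x. c' (f x)) (\<lambda>x. l' (f x)) ys"
      by (rule holds_cong) (simp_all only: c l in_base)
    moreover have "ys \<in> rels S q \<longleftrightarrow> holds q c l ys" using representsD[OF rep q ys] .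
    moreover have "map f ys \<in> rels S' q \<longleftrightarrow> holds q c' l' (map f ys)"
      by (rule representsD[OF rep' q]) (use ys base in \<open>auto simp: B_def B'_def y_def\<close>)
    ultimately show ?thesis by (simp only: holds_map)
  qed
  show ?thesis
    unfolding embedding_def
  proof (intro conjI ballI)
    show "inj_on f (base_set S)" "f ` base_set S \<subseteq> base_set S'" using inj fB by (simp_all only: B_def B'_def)
    fix q xs assume q: "q \<in> symbols \<sigma>" and "xs \<in> tuples (arity \<sigma> q) (base_set S)"
    then have xs: "set xs \<subseteq> B" "length xs = arity \<sigma> q" by (auto simp: tuples_def B_def)
    have "\<exists>i\<le>m. ks ! i \<notin> set xs"
    proof (rule ccontr)
      assume "\<not> ?thesis"
      then have "set (take (Suc m) ks) \<subseteq> set xs" by (auto simp: in_set_conv_nth less_Suc_eq_le)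
      then have "card (set (take (Suc m) ks)) \<le> card (set xs)" by (simp add: card_mono)
      also have "\<dots> \<le> m" using card_length[of xs] xs arity_le[OF q] by simp
      finally show False using S ksB(2) distinct_card[of "take (Suc m) ks"] by (simp add: framed_def)
    qed
    then obtain i where i: "i \<le> m" "ks ! i \<notin> set xs" by blast
    define T T' where "T = B - {ks ! i}" and "T' = B' - {ks' ! i}"
    have iks: "i < length ks" "ks ! i \<in> B" using i ksB nth_mem[of i ks] by auto
    have frS: "max_represents S T (C i) (L i)" "y \<noteq> ks ! i" "L i y \<notin> pivots T (C i) (L i)"
      "\<And>t. t \<in> T \<Longrightarrow> L i t \<in> pivots T (C i) (L i) \<or> L i t = L i y \<Longrightarrow> t \<in> set ks"
      using S i(1) unfolding framed_def Let_def T_def B_def y_def by blast+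
    have frS': "represents S' T' (C' i) (L' i)"
      using S' i(1) unfolding framed_def Let_def T'_def B'_def max_represents_def by blast
    show "xs \<in> rels S q \<longleftrightarrow> map f xs \<in> rels S' q"
    proof (rule local_label_preserved[OF _ frS(1) frS', where f = f and ks = ks and ks' = ks' and y = y])
      show "finite T" using S by (simp add: framed_def T_def B_def)
      show "f ` T \<subseteq> T'" using fB inj ks[OF iks(1)] iks(2) by (auto simp: T_def T'_def inj_on_def)
      show "inj_on f T" using inj by (rule inj_on_subset) (simp add: T_def)
      show "local_label S T ks (C i) (L i) t = local_label S' T' ks' (C' i) (L' i) (f t)" if "t \<in> T" for t
      proof -
        have "label S ks C L t = label S' ks' C' L' (f t)" using lab that by (simp add: T_def B_def)
        then have "map (\<lambda>i. local_label S (base_set S - {ks ! i}) ks (C i) (L i) t) [0..<Suc m] ! i =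
          map (\<lambda>i. local_label S' (base_set S' - {ks' ! i}) ks' (C' i) (L' i) (f t)) [0..<Suc m] ! i"
          by (simp only: label_def prod.inject)
        then show ?thesis using i(1) by (simp add: T_def T'_def B_def B'_def del: upt_Suc)
      qed
      show "ys \<in> rels S q \<longleftrightarrow> map f ys \<in> rels S' q"
        if "q \<in> symbols \<sigma>" "set ys \<subseteq> T - {y}" "length ys = arity \<sigma> q" for q ys
        using away[OF that(1) _ that(3)] that(2) by (auto simp: T_def)
    qed (use frS ks q xs i(2) ksB(3) in \<open>auto simp: T_def\<close>)
  qed
qed

theorem large_structures_good:
  fixes S :: "nat \<Rightarrow> ('i, 'b) rel_structure"
  assumes "\<And>n. finite (base_set (S n))" "\<And>n. is_structure \<sigma> (S n)"
    and "\<And>n. Suc m * Suc pivot_bound < card (base_set (S n))"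
    and "\<And>n x. x \<in> base_set (S n) \<Longrightarrow> \<exists>c l. represents (S n) (base_set (S n) - {x}) c l"
  shows "\<exists>i j f. i < j \<and> embedding \<sigma> f (S i) (S j)"
proof -
  have "\<forall>n. \<exists>ks C L c l. framed (S n) ks C L c l" using ex_framed assms by blast
  then obtain ks C L c l where fr: "\<And>n. framed (S n) (ks n) (C n) (L n) (c n) (l n)" by metis
  obtain X where X: "finite X" "\<And>n s. label (S n) (ks n) (C n) (L n) s \<in> X"
    using finite_labels[where 'b = 'b] fr by metis
  \<comment> \<open>The point \<open>y n\<close> is not in the word, so its label travels with every
    element; nonemptiness of \<open>T i\<close> later makes it readable.\<close>
  define y T lab where "y n = ks n ! Suc m" and "T n = base_set (S n) - {y n}"
    and "lab n s = (label (S n) (ks n) (C n) (L n) s, label (S n) (ks n) (C n) (L n) (y n))" for n s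
  define w where "w n = word k (T n) (lab n) (c n) (l n)" for n
  have finT: "finite (T n)" for n using assms(1) by (simp add: T_def)
  have rep: "represents (S n) (T n) (c n) (l n)" for n using fr[of n] by (simp add: framed_def T_def y_def)
  have ws: "set (w n) \<subseteq> {u. set u \<subseteq> Pow (X \<times> X) \<and> length u = k}" for n
    unfolding w_def by (rule word_alphabet) (auto simp: lab_def X)
  have "finite {u. set u \<subseteq> Pow (X \<times> X) \<and> length u = k}"
    using X(1) by (intro finite_lists_length_eq) auto
  from higman_finite_alphabet[OF this ws]
  obtain i j where ij: "i < j" "subseq (w i) (w j)" by blast
  have "c i t < k" for t using rep[of i] by (simp add: represents_def)
  from subseq_word_map[OF finT finT this ij(2)[unfolded w_def]]
  obtain g where g: "\<And>t. t \<in> T i \<Longrightarrow> g t \<in> T j \<and> c j (g t) = c i t \<and> lab j (g t) = lab i t"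
    and ord: "\<And>s t. s \<in> T i \<Longrightarrow> t \<in> T i \<Longrightarrow> l i s < l i t \<longleftrightarrow> l j (g s) < l j (g t)" by blast
  have ne: "T i \<noteq> {}"
  proof
    assume "T i = {}"
    then have "base_set (S i) \<subseteq> {y i}" by (auto simp: T_def)
    then have "card (base_set (S i)) \<le> 1" using card_mono[of "{y i}" "base_set (S i)"] by simp
    then show False using assms(3)[of i] by simp
  qed
  define f where "f t = (if t = y i then y j else g t)" for t
  have "embedding \<sigma> f (S i) (S j)"
  proof (rule embedding_if_labels_preserved[OF fr fr])
    show "label (S i) (ks i) (C i) (L i) s = label (S j) (ks j) (C j) (L j) (f s)" if "s \<in> base_set (S i)" for s
    proof (cases "s = y i")
      case True
      obtain t where "t \<in> T i" using ne by blast
      then show ?thesis using g[of t] True by (simp add: f_def lab_def)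
    next
      case False
      then show ?thesis using g[of s] that by (simp add: f_def lab_def T_def)
    qed
  qed (use g ord in \<open>auto simp: f_def T_def y_def\<close>)
  then show ?thesis using ij(1) by blast
qed

end

section \<open>Almost multichainable structures\<close>

definition rank_in :: "('a \<Rightarrow> 'a \<Rightarrow> bool) \<Rightarrow> 'a set \<Rightarrow> 'a \<Rightarrow> nat" where
  "rank_in lt A x = card {y \<in> A. lt y x}"

text \<open>Counting predecessors turns a strict weak order on a finite set into natural-number
  levels; \<open>weak\<close> says that incomparability is transitive.\<close>

lemma rank_in_less_iff:
  assumes "finite A"
    and irr: "\<And>x. \<not> lt x x"
    and trans: "\<And>x y z. lt x y \<Longrightarrow> lt y z \<Longrightarrow> lt x z"
    and weak: "\<And>x y z. x \<in> A \<Longrightarrow> y \<in> A \<Longrightarrow> z \<in> A \<Longrightarrow> lt x z \<Longrightarrow> lt x y \<or> lt y z"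
    and xy: "x \<in> A" "y \<in> A"
  shows "rank_in lt A x < rank_in lt A y \<longleftrightarrow> lt x y"
proof
  assume "lt x y"
  then have "{z \<in> A. lt z x} \<subset> {z \<in> A. lt z y}" using trans irr xy(1) by blast
  then show "rank_in lt A x < rank_in lt A y"
    unfolding rank_in_def using assms(1) by (intro psubset_card_mono) auto
next
  assume less: "rank_in lt A x < rank_in lt A y"
  show "lt x y"
  proof (rule ccontr)
    assume "\<not> lt x y"
    then have "{z \<in> A. lt z y} \<subseteq> {z \<in> A. lt z x}" using weak xy by blast
    then have "rank_in lt A y \<le> rank_in lt A x"
      unfolding rank_in_def using assms(1) by (intro card_mono) auto
    then show False using less by simp
  qed
qed

locale multichain =
  fixes \<sigma> :: "'i signature" and R :: "('i, 'a) rel_structure"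
    and F :: "'a set" and V :: "'v set" and L :: "'l set" and r and a :: "'v \<times> 'l \<Rightarrow> 'a"
  assumes finite_signature: "finite (symbols \<sigma>)"
    and R: "is_structure \<sigma> R"
    and F: "F \<subseteq> base_set R" "finite F" and V: "finite V"
    and r: "linear_order_on L r"
    and a: "bij_betw a (V \<times> L) (base_set R - F)"
    and homogeneous: "\<And>A f. order_local_isomorphism L r A f \<Longrightarrow>
      local_isomorphism \<sigma> R (F \<union> a ` (V \<times> A)) (lift_map F V L a f)"
begin

definition coord :: "'a \<Rightarrow> 'v \<times> 'l" where
  "coord = inv_into (V \<times> L) a"

lemma coord:
  assumes "z \<in> base_set R" "z \<notin> F"
  shows "coord z \<in> V \<times> L" and "a (coord z) = z"
proof -
  have "z \<in> a ` (V \<times> L)" using a assms by (auto simp: bij_betw_def)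
  then show "coord z \<in> V \<times> L" "a (coord z) = z"
    unfolding coord_def by (rule inv_into_into, rule f_inv_into_f)
qed

text \<open>A strict weak order: \<open>F\<close> is the lowest class, the other classes are the levels of \<open>L\<close>.\<close>

definition below :: "'a \<Rightarrow> 'a \<Rightarrow> bool" where
  "below z w \<longleftrightarrow> w \<in> base_set R - F \<and> z \<in> base_set R \<and>
     (z \<in> F \<or> (snd (coord z), snd (coord w)) \<in> r - Id)"

lemma order_facts:
  shows "(x, x) \<in> r \<longleftrightarrow> x \<in> L"
    and "(x, y) \<in> r \<Longrightarrow> (y, z) \<in> r \<Longrightarrow> (x, z) \<in> r"
    and "(x, y) \<in> r \<Longrightarrow> (y, x) \<in> r \<Longrightarrow> x = y"
    and "x \<in> L \<Longrightarrow> y \<in> L \<Longrightarrow> (x, y) \<in> r \<or> (y, x) \<in> r"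
proof -
  have refl: "refl_on L r" and "trans r" and "antisym r" and "total_on L r" and sub: "r \<subseteq> L \<times> L"
    using r by (auto simp: order_on_defs)
  show "(x, x) \<in> r \<longleftrightarrow> x \<in> L" using refl sub by (auto simp: refl_on_def)
  show "(x, y) \<in> r \<Longrightarrow> (y, z) \<in> r \<Longrightarrow> (x, z) \<in> r" using \<open>trans r\<close> by (auto dest: transD)
  show "(x, y) \<in> r \<Longrightarrow> (y, x) \<in> r \<Longrightarrow> x = y" using \<open>antisym r\<close> by (auto dest: antisymD)
  show "x \<in> L \<Longrightarrow> y \<in> L \<Longrightarrow> (x, y) \<in> r \<or> (y, x) \<in> r"
    using \<open>total_on L r\<close> refl by (cases "x = y") (auto simp: total_on_def refl_on_def)
qed

lemma snd_coord_in_L: "z \<in> base_set R \<Longrightarrow> z \<notin> F \<Longrightarrow> snd (coord z) \<in> L"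
  using coord(1)[of z] by (auto simp: mem_Times_iff)

lemma below_irrefl: "\<not> below z z"
  by (auto simp: below_def)

lemma below_trans: "below x y \<Longrightarrow> below y z \<Longrightarrow> below x z"
  unfolding below_def using order_facts(2)[of "snd (coord x)" "snd (coord y)" "snd (coord z)"]
    order_facts(3)[of "snd (coord x)" "snd (coord y)"] by auto

lemma below_weak: 
  assumes "x \<in> base_set R" "y \<in> base_set R" "z \<in> base_set R" "below x z"
  shows "below x y \<or> below y z"
proof (cases "y \<in> F")
  case True
  then show ?thesis using assms by (auto simp: below_def)
next
  case False
  have z: "z \<notin> F" using assms(4) by (simp add: below_def)
  show ?thesis
  proof (cases "x \<in> F")
    case True
    then show ?thesis using assms False by (auto simp: below_def)
  next
    case x: False
    then have xz: "(snd (coord x), snd (coord z)) \<in> r" "snd (coord x) \<noteq> snd (coord z)"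
      using assms(4) by (auto simp: below_def)
    have L: "snd (coord x) \<in> L" "snd (coord y) \<in> L" "snd (coord z) \<in> L"
      using snd_coord_in_L assms x False z by auto
    show ?thesis
    proof (cases "snd (coord x) = snd (coord y) \<or> (snd (coord x), snd (coord y)) \<notin> r")
      case True
      then have "(snd (coord y), snd (coord z)) \<in> r - Id"
        using xz L order_facts by (metis DiffI pair_in_Id_conv)
      then show ?thesis using assms False z by (auto simp: below_def)
    next
      case False
      then show ?thesis using assms \<open>y \<notin> F\<close> by (auto simp: below_def)
    qed
  qed
qed

text \<open>Each element of \<open>F\<close> is a letter of its own; elsewhere the letter is the
  coordinate in \<open>V\<close>.\<close>

definition same_letter :: "'a \<Rightarrow> 'a \<Rightarrow> bool" where
  "same_letter z w \<longleftrightarrow> (if z \<in> F \<or> w \<in> F then z = w else fst (coord z) = fst (coord w))"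

text \<open>The levels of \<open>zs\<close> map to those of \<open>ws\<close> by a local isomorphism
  of \<open>L\<close>, whose lift carries \<open>zs\<close> to \<open>ws\<close>. This is where
  homogeneity enters.\<close>

lemma rel_invariant:
  assumes q: "q \<in> symbols \<sigma>" and len: "length zs = arity \<sigma> q" "length ws = length zs"
    and base: "set zs \<subseteq> base_set R" "set ws \<subseteq> base_set R"
    and letters: "\<And>i. i < length zs \<Longrightarrow> same_letter (zs ! i) (ws ! i)"
    and order: "\<And>i j. i < length zs \<Longrightarrow> j < length zs \<Longrightarrow> below (zs ! i) (zs ! j) \<longleftrightarrow> below (ws ! i) (ws ! j)"
  shows "zs \<in> rels R q \<longleftrightarrow> ws \<in> rels R q"
proof -
  let ?I = "{i. i < length zs \<and> zs ! i \<notin> F}"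
  define A where "A = (\<lambda>i. snd (coord (zs ! i))) ` ?I"
  have zR: "zs ! i \<in> base_set R" and wR: "ws ! i \<in> base_set R" if "i < length zs" for i
    using that base len(2) nth_mem by (metis subsetD)+
  have wF: "ws ! i \<in> F \<longleftrightarrow> zs ! i \<in> F" if "i < length zs" for i
    using letters[OF that] by (auto simp: same_letter_def split: if_splits)
  have less: "(snd (coord (zs ! i)), snd (coord (zs ! j))) \<in> r - Id \<longleftrightarrow>
      (snd (coord (ws ! i)), snd (coord (ws ! j))) \<in> r - Id" if "i \<in> ?I" "j \<in> ?I" for i j
    using order[of i j] zR wR wF that by (simp add: below_def)
  have zL: "snd (coord (zs ! i)) \<in> L" and wL: "snd (coord (ws ! i)) \<in> L" if "i \<in> ?I" for i
    using that zR wR wF by (auto intro: snd_coord_in_L)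
  \<comment> \<open>In a linear order two levels are equal exactly when neither is strictly below
    the other.\<close>
  have eq: "snd (coord (zs ! i)) = snd (coord (zs ! j)) \<longleftrightarrow> snd (coord (ws ! i)) = snd (coord (ws ! j))"
    if "i \<in> ?I" "j \<in> ?I" for i j
    using less[OF that] less[OF that(2,1)] order_facts(4)[OF zL[OF that(1)] zL[OF that(2)]]
      order_facts(4)[OF wL[OF that(1)] wL[OF that(2)]] unfolding Diff_iff pair_in_Id_conv by metis
  define f where "f y = snd (coord (ws ! (SOME i. i \<in> ?I \<and> snd (coord (zs ! i)) = y)))" for y
  have f: "f (snd (coord (zs ! i))) = snd (coord (ws ! i))" if i: "i \<in> ?I" for i
  proof -
    have "\<exists>j. j \<in> ?I \<and> snd (coord (zs ! j)) = snd (coord (zs ! i))" using i by blast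
    then have "(SOME j. j \<in> ?I \<and> snd (coord (zs ! j)) = snd (coord (zs ! i))) \<in> ?I \<and>
        snd (coord (zs ! (SOME j. j \<in> ?I \<and> snd (coord (zs ! j)) = snd (coord (zs ! i))))) = snd (coord (zs ! i))"
      by (rule someI_ex)
    then show ?thesis unfolding f_def using eq[OF _ i] by blast
  qed
  have "order_local_isomorphism L r A f"
    unfolding order_local_isomorphism_def
  proof (intro conjI ballI)
    show "A \<subseteq> L" using zL by (auto simp: A_def)
    show "f ` A \<subseteq> L" using f wL by (auto simp: A_def)
    show "inj_on f A" unfolding A_def by (rule inj_onI) (use f eq in auto)
    fix y y' assume "y \<in> A" "y' \<in> A"
    then obtain i j where ij: "i \<in> ?I" "j \<in> ?I" and y: "y = snd (coord (zs ! i))" "y' = snd (coord (zs ! j))"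
      unfolding A_def by blast
    have "(y, y') \<in> r \<longleftrightarrow> (snd (coord (ws ! i)), snd (coord (ws ! j))) \<in> r"
      unfolding y using less[OF ij] eq[OF ij] zL[OF ij(1)] wL[OF ij(1)] order_facts(1) by auto
    then show "(y, y') \<in> r \<longleftrightarrow> (f y, f y') \<in> r" using f ij y by simp
  qed
  then have iso: "isomorphism \<sigma> (lift_map F V L a f) (induced R (F \<union> a ` (V \<times> A)))
      (induced R (lift_map F V L a f ` (F \<union> a ` (V \<times> A))))"
    using homogeneous by (auto simp: local_isomorphism_def)
  have dom: "zs ! i \<in> F \<union> a ` (V \<times> A)" if i: "i < length zs" for i
  proof (cases "zs ! i \<in> F")
    case False
    then have "snd (coord (zs ! i)) \<in> A" using i by (auto simp: A_def)
    then have "coord (zs ! i) \<in> V \<times> A" using coord(1)[OF zR[OF i] False] by (auto simp: mem_Times_iff)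
    then show ?thesis using coord(2)[OF zR[OF i] False] by (metis UnI2 imageI)
  qed simp
  have lift: "lift_map F V L a f (zs ! i) = ws ! i" if i: "i < length zs" for i
  proof (cases "zs ! i \<in> F")
    case True
    then show ?thesis using letters[OF i] by (simp add: lift_map_def same_letter_def)
  next
    case False
    have "lift_map F V L a f (zs ! i) = a (fst (coord (zs ! i)), f (snd (coord (zs ! i))))"
      using False by (simp add: lift_map_def coord_def split: prod.splits)
    also have "\<dots> = a (fst (coord (ws ! i)), snd (coord (ws ! i)))"
      using False f[of i] i letters[OF i] wF[OF i] by (simp add: same_letter_def)
    also have "\<dots> = ws ! i" using coord(2)[OF wR[OF i]] False wF[OF i] by simp
    finally show ?thesis .
  qed
  have map: "map (lift_map F V L a f) zs = ws" using lift len(2) by (intro nth_equalityI) auto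
  have zs_dom: "set zs \<subseteq> F \<union> a ` (V \<times> A)" using dom by (metis in_set_conv_nth subsetI)
  then have "zs \<in> tuples (arity \<sigma> q) (base_set (induced R (F \<union> a ` (V \<times> A))))"
    using base len by (auto simp: tuples_def induced_def)
  then have "zs \<in> rels (induced R (F \<union> a ` (V \<times> A))) q \<longleftrightarrow>
      ws \<in> rels (induced R (lift_map F V L a f ` (F \<union> a ` (V \<times> A)))) q"
    using iso q map unfolding isomorphism_def by metis
  moreover have "zs \<in> lists (F \<union> a ` (V \<times> A))" using zs_dom by (simp add: in_lists_conv_set subset_iff)
  moreover have "ws \<in> lists (lift_map F V L a f ` (F \<union> a ` (V \<times> A)))"
    using zs_dom unfolding map[symmetric] by (auto simp: in_lists_conv_set)
  ultimately show ?thesis by (simp add: induced_def)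
qed

lemma ex_letter_code:
  "\<exists>(code :: 'a \<Rightarrow> nat) k. (\<forall>z. code z < k) \<and>
     (\<forall>z\<in>base_set R. \<forall>w\<in>base_set R. code z = code w \<longrightarrow> same_letter z w)"
proof -
  obtain g :: "'a \<Rightarrow> nat" where g: "inj_on g F" using F(2) finite_imp_inj_to_nat_seg by metis
  obtain h :: "'v \<Rightarrow> nat" where h: "inj_on h V" using V finite_imp_inj_to_nat_seg by metis
  \<comment> \<open>Even values for \<open>F\<close>, odd ones for \<open>V\<close>. The default 0
    is taken only outside the base set, where nothing has to be separated.\<close>
  define code where "code z = (if z \<in> F then 2 * g z else if fst (coord z) \<in> V then Suc (2 * h (fst (coord z))) else 0)" for z
  have "range code \<subseteq> (\<lambda>z. 2 * g z) ` F \<union> (\<lambda>v. Suc (2 * h v)) ` V \<union> {0}"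
    by (auto simp: code_def)
  then have "finite (range code)" using F(2) V by (meson finite.emptyI finite_UnI finite_imageI finite_insert finite_subset)
  then obtain k where k: "range code \<subseteq> {..<k}" by (metis finite_nat_iff_bounded)
  have "same_letter z w" if zw: "z \<in> base_set R" "w \<in> base_set R" "code z = code w" for z w
  proof -
    have V': "fst (coord x) \<in> V" if "x \<in> base_set R" "x \<notin> F" for x
      using coord(1)[OF that] by (simp add: mem_Times_iff)
    consider "z \<in> F" "w \<in> F" | "z \<in> F" "w \<notin> F" | "z \<notin> F" "w \<in> F" | "z \<notin> F" "w \<notin> F" by blast
    then show ?thesis
    proof cases
      case 1
      then show ?thesis using zw g by (auto simp: code_def same_letter_def dest: inj_onD)
    next
      case 2
      then have "2 * g z = Suc (2 * h (fst (coord w)))" using zw V' by (simp add: code_def)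
      then have False by presburger
      then show ?thesis ..
    next
      case 3
      then have "2 * g w = Suc (2 * h (fst (coord z)))" using zw V' by (simp add: code_def)
      then have False by presburger
      then show ?thesis ..
    next
      case 4
      then show ?thesis using zw V' h by (auto simp: code_def same_letter_def dest: inj_onD)
    qed
  qed
  then show ?thesis using k by (intro exI[of _ code] exI[of _ k]) (auto simp: image_subset_iff)
qed

text \<open>Patterns with more levels than \<open>L\<close> has elements hold nowhere, so a finite \<open>L\<close> needs no separate
  treatment.\<close>

definition pattern_holds :: "('a \<Rightarrow> nat) \<Rightarrow> 'i \<Rightarrow> (nat \<times> nat) list \<Rightarrow> bool" where
  "pattern_holds code q ps \<longleftrightarrow> (\<exists>zs\<in>rels R q. set zs \<subseteq> base_set R \<and> map code zs = map fst ps \<and>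
     (\<forall>i<length zs. \<forall>j<length zs. below (zs ! i) (zs ! j) \<longleftrightarrow> snd (ps ! i) < snd (ps ! j)))"

lemma order_pattern_pattern_holds: "order_pattern (pattern_holds code)"
proof
  fix q and xs ys :: "(nat \<times> nat) list"
  assume fst: "map fst xs = map fst ys"
    and snd: "\<And>i j. i < length xs \<Longrightarrow> j < length xs \<Longrightarrow> snd (xs ! i) < snd (xs ! j) \<longleftrightarrow> snd (ys ! i) < snd (ys ! j)"
  have "length zs = length xs" if "map code zs = map fst ys" for zs using that fst by (metis length_map)
  then show "pattern_holds code q xs = pattern_holds code q ys"
    unfolding pattern_holds_def fst using snd by (intro bex_cong) auto
qed

text \<open>Letters are read off the images in \<open>R\<close>, and levels are the ranks of the
  images, which makes them natural numbers whatever the order type of \<open>L\<close>.\<close>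

lemma represents_if_embedding:
  assumes code: "\<And>z. code z < k" "\<And>z w. z \<in> base_set R \<Longrightarrow> w \<in> base_set R \<Longrightarrow> code z = code w \<Longrightarrow> same_letter z w"
    and m: "\<And>q. q \<in> symbols \<sigma> \<Longrightarrow> arity \<sigma> q \<le> m"
    and fin: "finite T" and emb: "embeds \<sigma> (induced S T) R" and T: "T \<subseteq> base_set S"
  shows "\<exists>c l. represented_class.represents (pattern_holds code) \<sigma> k S T c l"
proof -
  interpret represented_class m "pattern_holds code" \<sigma> k
    by (rule represented_class.intro[OF order_pattern_pattern_holds represented_class_axioms.intro])
      (fact finite_signature, fact m)
  obtain g where g: "embedding \<sigma> g (induced S T) R" using emb unfolding embeds_iff_embedding by blast
  have TT: "base_set S \<inter> T = T" using T by blast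
  have inj: "inj_on g T" and gR: "g ` T \<subseteq> base_set R" using g by (simp_all add: embedding_def induced_def TT)
  define l where "l t = rank_in below (g ` T) (g t)" for t
  have l: "l s < l t \<longleftrightarrow> below (g s) (g t)" if "s \<in> T" "t \<in> T" for s t
    unfolding l_def
  proof (rule rank_in_less_iff)
    show "below x y \<or> below y z" if "x \<in> g ` T" "y \<in> g ` T" "z \<in> g ` T" "below x z" for x y z
      using below_weak[OF _ _ _ that(4), of y] that(1-3) gR by blast
  qed (use fin that below_irrefl below_trans in blast)+
  have "represents S T (\<lambda>t. code (g t)) l"
    unfolding represents_def
  proof (intro conjI allI ballI)
    show "code (g t) < k" for t using code(1) .
    show "inj_on (\<lambda>t. (code (g t), l t)) T"
    proof (rule inj_onI)
      fix s t assume st: "s \<in> T" "t \<in> T" "(code (g s), l s) = (code (g t), l t)"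
      then have R: "g s \<in> base_set R" "g t \<in> base_set R" using gR by auto
      have same: "same_letter (g s) (g t)" using st code(2)[OF R] by simp
      have nb: "\<not> below (g s) (g t)" "\<not> below (g t) (g s)" using l[of s t] l[of t s] st by auto
      have "g s = g t"
      proof (cases "g s \<in> F \<or> g t \<in> F")
        case True
        then show ?thesis using same by (simp add: same_letter_def)
      next
        case False
        then have "snd (coord (g s)) = snd (coord (g t))"
          using nb R order_facts(4)[OF snd_coord_in_L snd_coord_in_L, of "g s" "g t"] by (auto simp: below_def)
        moreover have "fst (coord (g s)) = fst (coord (g t))" using same False by (simp add: same_letter_def)
        ultimately have "coord (g s) = coord (g t)" by (simp add: prod_eq_iff)
        then show ?thesis using coord(2) R False by metis
      qed
      then show "s = t" using inj st by (auto dest: inj_onD)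
    qed
    fix q xs assume q: "q \<in> symbols \<sigma>" and xs: "xs \<in> tuples (arity \<sigma> q) T"
    then have xs': "set xs \<subseteq> T" "length xs = arity \<sigma> q" by (auto simp: tuples_def)
    have gxs: "set (map g xs) \<subseteq> base_set R" using xs' gR by auto
    have ord: "below (g (xs ! i)) (g (xs ! j)) \<longleftrightarrow> l (xs ! i) < l (xs ! j)" if "i < length xs" "j < length xs" for i j
      using l xs'(1) that nth_mem by (metis subsetD)
    have "xs \<in> rels S q \<longleftrightarrow> map g xs \<in> rels R q"
    proof -
      have "xs \<in> rels (induced S T) q \<longleftrightarrow> map g xs \<in> rels R q"
        using g q xs unfolding embedding_def by (simp add: induced_def TT)
      moreover have "xs \<in> lists T" using xs' by (simp add: in_lists_conv_set subset_iff)
      ultimately show ?thesis by (simp add: induced_def)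
    qed
    also have "\<dots> \<longleftrightarrow> pattern_holds code q (map (\<lambda>x. (code (g x), l x)) xs)"
    proof
      assume "map g xs \<in> rels R q"
      then show "pattern_holds code q (map (\<lambda>x. (code (g x), l x)) xs)"
        unfolding pattern_holds_def using gxs ord by (intro bexI[of _ "map g xs"]) auto
    next
      assume "pattern_holds code q (map (\<lambda>x. (code (g x), l x)) xs)"
      then obtain zs where zs: "zs \<in> rels R q" "set zs \<subseteq> base_set R"
        and c: "map code zs = map (\<lambda>x. code (g x)) xs"
        and o: "\<And>i j. i < length zs \<Longrightarrow> j < length zs \<Longrightarrow> below (zs ! i) (zs ! j) \<longleftrightarrow>
          snd (map (\<lambda>x. (code (g x), l x)) xs ! i) < snd (map (\<lambda>x. (code (g x), l x)) xs ! j)"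
        unfolding pattern_holds_def by (auto simp: comp_def)
      have len: "length zs = length xs" using c by (metis length_map)
      \<comment> \<open>The witness \<open>zs\<close> of the pattern need not be the image of
        \<open>xs\<close>, but it has the same letters and the same order, so
        \<open>rel_invariant\<close> transfers membership.\<close>
      have "zs \<in> rels R q \<longleftrightarrow> map g xs \<in> rels R q"
      proof (rule rel_invariant[OF q _ _ zs(2) gxs])
        show "same_letter (zs ! i) (map g xs ! i)" if i: "i < length zs" for i
        proof (rule code(2))
          show "zs ! i \<in> base_set R" "map g xs ! i \<in> base_set R"
            using i len zs(2) gxs nth_mem by (metis subsetD length_map)+
          show "code (zs ! i) = code (map g xs ! i)"
            using arg_cong[OF c, of "\<lambda>u. u ! i"] i len by simp
        qed
        show "below (zs ! i) (zs ! j) \<longleftrightarrow> below (map g xs ! i) (map g xs ! j)"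
          if "i < length zs" "j < length zs" for i j
          using o[OF that] ord[of i j] that len by simp
      qed (use len xs' in auto)
      then show "map g xs \<in> rels R q" using zs(1) by simp
    qed
    finally show "xs \<in> rels S q \<longleftrightarrow> pattern_holds code q (map (\<lambda>x. (code (g x), l x)) xs)" .
  qed
  then show ?thesis by blast
qed

theorem finitely_many_bounds:
  "finite ({S :: ('i, 'b) rel_structure. is_bound \<sigma> R S} // isomorphism_relation \<sigma>)"
proof -
  obtain code :: "'a \<Rightarrow> nat" and k where code: "\<And>z. code z < k"
    "\<And>z w. z \<in> base_set R \<Longrightarrow> w \<in> base_set R \<Longrightarrow> code z = code w \<Longrightarrow> same_letter z w"
    using ex_letter_code by blast
  \<comment> \<open>Inserting 0 keeps the maximum defined for an empty signature.\<close>
  define m where "m = Max (insert 0 (arity \<sigma> ` symbols \<sigma>))"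
  have m: "arity \<sigma> q \<le> m" if "q \<in> symbols \<sigma>" for q
    unfolding m_def using finite_signature that by (intro Max_ge) auto
  interpret represented_class m "pattern_holds code" \<sigma> k
    by (rule represented_class.intro[OF order_pattern_pattern_holds represented_class_axioms.intro])
      (fact finite_signature, fact m)
  let ?M = "Suc m * Suc pivot_bound"
  let ?small = "{S :: ('i, 'b) rel_structure. is_bound \<sigma> R S \<and> card (base_set S) \<le> ?M}"
  let ?large = "{S :: ('i, 'b) rel_structure. is_bound \<sigma> R S \<and> ?M < card (base_set S)}"
  have iso_rel: "(S, T) \<in> isomorphism_relation \<sigma>"
    if "is_bound \<sigma> R S" "is_bound \<sigma> R T" "isomorphic \<sigma> S T" for S T :: "('i, 'b) rel_structure"
    using that by (simp add: isomorphism_relation_def is_bound_def)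
  have small: "finite (?small // isomorphism_relation \<sigma>)"
  proof (rule finite_quotient_if_good[OF equiv_isomorphism_relation])
    show "?small \<subseteq> {S. is_structure \<sigma> S}" by (auto simp: is_bound_def)
    fix s :: "nat \<Rightarrow> ('i, 'b) rel_structure" assume s: "\<And>n. s n \<in> ?small"
    then have "finite (base_set (s n)) \<and> card (base_set (s n)) \<le> ?M" for n by (auto simp: is_bound_def)
    from isomorphic_if_bounded_size[OF finite_signature this]
    obtain i j where ij: "i \<noteq> j" "isomorphic \<sigma> (s i) (s j)" by blast
    have "(s i, s j) \<in> isomorphism_relation \<sigma>" by (rule iso_rel) (use s ij in auto)
    then show "\<exists>i j. i \<noteq> j \<and> (s i, s j) \<in> isomorphism_relation \<sigma>" using ij(1) by blast
  qed
  have large: "finite (?large // isomorphism_relation \<sigma>)"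
  proof (rule finite_quotient_if_good[OF equiv_isomorphism_relation])
    show "?large \<subseteq> {S. is_structure \<sigma> S}" by (auto simp: is_bound_def)
    fix s :: "nat \<Rightarrow> ('i, 'b) rel_structure" assume s: "\<And>n. s n \<in> ?large"
    then have b: "is_bound \<sigma> R (s n)" "?M < card (base_set (s n))" for n by auto
    have "\<exists>i j f. i < j \<and> embedding \<sigma> f (s i) (s j)"
    proof (rule large_structures_good)
      show "\<exists>c l. represents (s n) (base_set (s n) - {x}) c l" if "x \<in> base_set (s n)" for n x
        by (rule represents_if_embedding[OF code m]) (use b(1)[of n] that in \<open>auto simp: is_bound_def\<close>)
    qed (use b in \<open>auto simp: is_bound_def\<close>)
    then obtain i j f where ij: "i < j" and f: "embedding \<sigma> f (s i) (s j)" by blast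
    have "isomorphic \<sigma> (s i) (s j)" using bounds_antichain[OF b(1) b(1) f] by (auto simp: isomorphic_def)
    then have "(s i, s j) \<in> isomorphism_relation \<sigma>" by (rule iso_rel[OF b(1) b(1)])
    then show "\<exists>i j. i \<noteq> j \<and> (s i, s j) \<in> isomorphism_relation \<sigma>"
      using ij by (intro exI[of _ i] exI[of _ j]) simp
  qed
  have "{S. is_bound \<sigma> R S} = ?small \<union> ?large" by (auto simp: not_le)
  then have "{S. is_bound \<sigma> R S} // isomorphism_relation \<sigma> =
      (?small // isomorphism_relation \<sigma>) \<union> (?large // isomorphism_relation \<sigma>)"
    by (simp only: quotient_def UN_Un)
  then show ?thesis using small large by simp
qed

end

theorem mainTheorem11:
  fixes \<sigma> :: "'i signature" and R :: "('i, 'a) rel_structure"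
  assumes "finite (symbols \<sigma>)"
    and "is_structure \<sigma> R"
    and "almost_multichainable TYPE('v) TYPE('l) \<sigma> R"
  shows "finite ({S :: ('i, 'b) rel_structure. is_bound \<sigma> R S} // isomorphism_relation \<sigma>)"
proof -
  obtain F :: "'a set" and V :: "'v set" and L :: "'l set" and r a where "multichain \<sigma> R F V L r a"
    using assms unfolding almost_multichainable_def multichain_def by blast
  then show ?thesis by (rule multichain.finitely_many_bounds)
qed

end
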